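(* Let $\mathbf{L}$ be a normed space and $L^\nu$ a finite-dimensional contractively complemented subspace of $\mathbf{L}$. Then the space $(L^\nu)^*$, supplied with the minimal $\mathbf{L}$-norm (that is, the injective tensor norm on $\mathbf{L}\otimes(L^\nu)^*$), is the $\odot_\nu$-free $\mathbf{L}$-space whose base is a singleton.
   Context: All linear spaces are over a fixed scalar field ($\mathbb{R}$ or $\mathbb{C}$). Fix a normed space $\mathbf{L}$; $\mathcal{B}(\mathbf{L})$ is the algebra of bounded operators on $\mathbf{L}$; $\otimes$ is the algebraic tensor product. For a linear space $E$, $\mathbf{L}\otimes E$ is a left $\mathcal{B}(\mathbf{L})$-module via $a\cdot(\xi\otimes x)=a\xi\otimes x$. An $\mathbf{L}$-norm on $E$ is a norm on $\mathbf{L}\otimes E$ with $\|a\cdot u\|\le\|a\|\|u\|$ for all $a\in\mathcal{B}(\mathbf{L})$, $u\in\mathbf{L}\otimes E$; an $\mathbf{L}$-space is a linear space endowed with an $\mathbf{L}$-norm. For a linear operator $\varphi:G\to E$ between $\mathbf{L}$-spaces put $\varphi_\infty:=\mathbf{1}_{\mathbf{L}}\otimes\varphi$; $\varphi$ is $\mathbf{L}$-contractive if $\|\varphi_\infty\|\le 1$. $\mathcal{CC}(G,E)$ is the set of $\mathbf{L}$-contractive operators $G\to E$. $\mathbf{L}\mathbf{Nor}_1$ is the category of $\mathbf{L}$-spaces and $\mathbf{L}$-contractive operators. A subspace of $\mathbf{L}$ is contractively complemented if it is the range of a projection on $\mathbf{L}$ of norm at most $1$. For such a subspace $L^\nu$,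 the functor $\odot_\nu:\mathbf{L}\mathbf{Nor}_1\to\mathbf{Set}$ takes $E$ to $B^\nu_E$, the closed unit ball of $L^\nu\otimes E$ (with the norm induced from $\mathbf{L}\otimes E$), and takes $\varphi\in\mathcal{CC}(G,E)$ to the restriction of $\varphi_\infty$ to a map $B^\nu_G\to B^\nu_E$. For a functor $\square:\mathbf{L}\mathbf{Nor}_1\to\mathbf{Set}$ and a set $M$, an $\mathbf{L}$-space $\mathbf{F}$ is called a $\square$-free $\mathbf{L}$-space with the base $M$ if for every $\mathbf{L}$-space $E$ there is a bijection $\mathbf{I}_E:\mathbf{Set}(M,\square E)\to\mathcal{CC}(\mathbf{F},E)$, and these bijections are natural: $\varphi\circ\mathbf{I}_G(f)=\mathbf{I}_E((\square\varphi)\circ f)$ for all $\varphi\in\mathcal{CC}(G,E)$ and $f:M\to\square G$. Free spaces with a given base are unique up to isomorphism in $\mathbf{L}\mathbf{Nor}_1$. *)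

theory Defs
  imports "HOL-Analysis.Analysis" "HOL-Algebra.Module"
begin

subsection \<open>Scalars and normed spaces\<close>

text \<open>The scalar field is \<open>\<real>\<close> or \<open>\<complex>\<close>: a normed field that is isometrically isomorphic
  to one of the two.\<close>

class real_or_complex = real_normed_field +
  assumes real_or_complex:
    "\<exists>h :: 'a \<Rightarrow> complex.
       (\<forall>x y. h (x + y) = h x + h y) \<and> (\<forall>x y. h (x * y) = h x * h y) \<and>
       (\<forall>x. cmod (h x) = norm x) \<and> (range h = \<real> \<or> range h = UNIV)"

instance real :: real_or_complex
  by standard (rule exI[of _ complex_of_real], simp add: Reals_def)

instance complex :: real_or_complex
  by standard (rule exI[of _ id], simp)

text \<open>The fixed normed space \<open>L\<close> is a type with its norm, together with a scalar multiplication
  \<open>sc\<close> by \<open>'k\<close>.  The spaces \<open>E\<close> that are quantified over are instead carrier based.\<close>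

locale normed_space = vector_space sc
  for sc :: "'k::real_or_complex \<Rightarrow> 'l::real_normed_vector \<Rightarrow> 'l" +
  assumes norm_sc: "norm (sc c \<xi>) = norm c * norm \<xi>"

definition bounded_operator ::
  "('k::real_or_complex \<Rightarrow> 'l::real_normed_vector \<Rightarrow> 'l) \<Rightarrow>
   ('k \<Rightarrow> 'm::real_normed_vector \<Rightarrow> 'm) \<Rightarrow> ('l \<Rightarrow> 'm) \<Rightarrow> bool"
  where "bounded_operator s t a \<longleftrightarrow> Vector_Spaces.linear s t a \<and> bounded_linear a"

definition contractively_complemented ::
  "('k::real_or_complex \<Rightarrow> 'l::real_normed_vector \<Rightarrow> 'l) \<Rightarrow> 'l set \<Rightarrow> bool"
  where "contractively_complemented sc N \<longleftrightarrow>
    (\<exists>P. bounded_operator sc sc P \<and> P \<circ> P = P \<and> onorm P \<le> 1 \<and> range P = N)"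

definition finite_dimensional ::
  "('k::real_or_complex \<Rightarrow> 'l::real_normed_vector \<Rightarrow> 'l) \<Rightarrow> 'l set \<Rightarrow> bool"
  where "finite_dimensional sc N \<longleftrightarrow> (\<exists>B. finite B \<and> module.span sc B = N)"


subsection \<open>Linear spaces with a carrier\<close>

definition scalar_ring :: "'k::real_or_complex ring"
  where "scalar_ring = \<lparr>carrier = UNIV, mult = (*), one = 1, zero = 0, add = (+)\<rparr>"

abbreviation linear_space :: "('k::real_or_complex, 'e, 'z) module_scheme \<Rightarrow> bool"
  where "linear_space E \<equiv> Module.module scalar_ring E"

definition linear_form :: "('k::real_or_complex, 'e, 'z) module_scheme \<Rightarrow> ('e \<Rightarrow> 'k) \<Rightarrow> bool"
  where "linear_form E g \<longleftrightarrow>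
    (\<forall>x\<in>carrier E. \<forall>y\<in>carrier E. g (x \<oplus>\<^bsub>E\<^esub> y) = g x + g y) \<and>
    (\<forall>c. \<forall>x\<in>carrier E. g (c \<odot>\<^bsub>E\<^esub> x) = c * g x)"

definition linear_operators ::
  "('k::real_or_complex, 'g, 'y) module_scheme \<Rightarrow> ('k, 'e, 'z) module_scheme \<Rightarrow> ('g \<Rightarrow> 'e) set"
  where "linear_operators G E = {\<phi> \<in> carrier G \<rightarrow>\<^sub>E carrier E.
    (\<forall>x\<in>carrier G. \<forall>y\<in>carrier G. \<phi> (x \<oplus>\<^bsub>G\<^esub> y) = \<phi> x \<oplus>\<^bsub>E\<^esub> \<phi> y) \<and>
    (\<forall>c. \<forall>x\<in>carrier G. \<phi> (c \<odot>\<^bsub>G\<^esub> x) = c \<odot>\<^bsub>E\<^esub> \<phi> x)}"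


subsection \<open>The algebraic tensor product\<close>

text \<open>The algebraic tensor product \<open>L \<otimes> E\<close> is realised, as in Ryan's Introduction to Tensor
  Products of Banach Spaces, as a space of functionals on the bilinear forms on \<open>L \<times> E\<close>:
  the elementary tensor of \<open>\<xi>\<close> and \<open>x\<close> is evaluation at \<open>(\<xi>, x)\<close>.  Linear operations on tensors
  are pointwise.  Functionals are set to 0 off the bilinear forms, so that equality of tensors is
  equality of functions.\<close>

type_synonym ('k, 'l, 'e) tensor = "('l \<Rightarrow> 'e \<Rightarrow> 'k) \<Rightarrow> 'k"

definition bilinear_forms ::
  "('k::real_or_complex \<Rightarrow> 'l::real_normed_vector \<Rightarrow> 'l) \<Rightarrow> ('k, 'e, 'z) module_scheme \<Rightarrow>
   ('l \<Rightarrow> 'e \<Rightarrow> 'k) set"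
  where "bilinear_forms sc E = {B.
    (\<forall>x\<in>carrier E. Vector_Spaces.linear sc (*) (\<lambda>\<xi>. B \<xi> x)) \<and> (\<forall>\<xi>. linear_form E (B \<xi>))}"

definition elementary_tensor ::
  "('k::real_or_complex \<Rightarrow> 'l::real_normed_vector \<Rightarrow> 'l) \<Rightarrow> ('k, 'e, 'z) module_scheme \<Rightarrow>
   'l \<Rightarrow> 'e \<Rightarrow> ('k, 'l, 'e) tensor"
  where "elementary_tensor sc E \<xi> x = (\<lambda>B. if B \<in> bilinear_forms sc E then B \<xi> x else 0)"

text \<open>For a subspace \<open>N\<close> of \<open>L\<close>, the space \<open>N \<otimes> E\<close> is identified with its image in \<open>L \<otimes> E\<close>;
  \<open>L \<otimes> E\<close> itself is the case \<open>N = UNIV\<close>.\<close>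

definition tensor_product ::
  "('k::real_or_complex \<Rightarrow> 'l::real_normed_vector \<Rightarrow> 'l) \<Rightarrow> 'l set \<Rightarrow>
   ('k, 'e, 'z) module_scheme \<Rightarrow> ('k, 'l, 'e) tensor set"
  where "tensor_product sc N E =
    {(\<lambda>B. \<Sum>i<n. elementary_tensor sc E (\<xi> i) (x i) B) | (n::nat) \<xi> x.
       \<forall>i<n. \<xi> i \<in> N \<and> x i \<in> carrier E}"

text \<open>The operator \<open>a \<otimes> \<phi>\<close> with values in \<open>L \<otimes> E\<close>.\<close>

definition tensor_map ::
  "('k::real_or_complex \<Rightarrow> 'l::real_normed_vector \<Rightarrow> 'l) \<Rightarrow> ('k, 'e, 'z) module_scheme \<Rightarrow>
   ('l \<Rightarrow> 'l) \<Rightarrow> ('g \<Rightarrow> 'e) \<Rightarrow> ('k, 'l, 'g) tensor \<Rightarrow> ('k, 'l, 'e) tensor"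
  where "tensor_map sc E a \<phi> u =
    (\<lambda>B. if B \<in> bilinear_forms sc E then u (\<lambda>\<xi> x. B (a \<xi>) (\<phi> x)) else 0)"

lemma tensor_map_elementary:
  assumes a: "Vector_Spaces.linear sc sc a"
    and \<phi>: "\<phi> \<in> carrier G \<rightarrow> carrier E"
      "\<And>x y. x \<in> carrier G \<Longrightarrow> y \<in> carrier G \<Longrightarrow> \<phi> (x \<oplus>\<^bsub>G\<^esub> y) = \<phi> x \<oplus>\<^bsub>E\<^esub> \<phi> y"
      "\<And>c x. x \<in> carrier G \<Longrightarrow> \<phi> (c \<odot>\<^bsub>G\<^esub> x) = c \<odot>\<^bsub>E\<^esub> \<phi> x"
  shows "tensor_map sc E a \<phi> (elementary_tensor sc G \<xi> x) = elementary_tensor sc E (a \<xi>) (\<phi> x)"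
proof -
  have "(\<lambda>\<xi> x. B (a \<xi>) (\<phi> x)) \<in> bilinear_forms sc G" if B: "B \<in> bilinear_forms sc E" for B
  proof -
    have "Vector_Spaces.linear sc (*) (\<lambda>\<xi>. B (a \<xi>) (\<phi> y))" if "y \<in> carrier G" for y
    proof -
      have "Vector_Spaces.linear sc (*) (\<lambda>\<xi>. B \<xi> (\<phi> y))"
        using B \<phi>(1) that by (auto simp: bilinear_forms_def)
      from Vector_Spaces.linear_compose[OF a this] show ?thesis by (simp add: o_def)
    qed
    moreover have "linear_form G (\<lambda>x. B (a \<eta>) (\<phi> x))" for \<eta>
      using B \<phi> by (auto simp: bilinear_forms_def linear_form_def Pi_iff)
    ultimately show ?thesis by (simp add: bilinear_forms_def)
  qed
  then show ?thesis by (auto simp: tensor_map_def elementary_tensor_def)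
qed


subsection \<open>L-spaces\<close>

record ('k, 'l, 'e) lspace = "('k, 'e) module" +
  lnorm :: "('k, 'l, 'e) tensor \<Rightarrow> real"

definition is_lspace ::
  "('k::real_or_complex \<Rightarrow> 'l::real_normed_vector \<Rightarrow> 'l) \<Rightarrow> ('k, 'l, 'e) lspace \<Rightarrow> bool"
  where "is_lspace sc E \<longleftrightarrow>
    linear_space E \<and>
    (\<forall>u\<in>tensor_product sc UNIV E. 0 \<le> lnorm E u \<and> (lnorm E u = 0 \<longleftrightarrow> u = (\<lambda>_. 0))) \<and>
    (\<forall>c. \<forall>u\<in>tensor_product sc UNIV E. lnorm E (\<lambda>B. c * u B) = norm c * lnorm E u) \<and>
    (\<forall>u\<in>tensor_product sc UNIV E. \<forall>v\<in>tensor_product sc UNIV E.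
       lnorm E (\<lambda>B. u B + v B) \<le> lnorm E u + lnorm E v) \<and>
    (\<forall>a. bounded_operator sc sc a \<longrightarrow> (\<forall>u\<in>tensor_product sc UNIV E.
       lnorm E (tensor_map sc E a id u) \<le> onorm a * lnorm E u))"

definition lcontractive_operators ::
  "('k::real_or_complex \<Rightarrow> 'l::real_normed_vector \<Rightarrow> 'l) \<Rightarrow>
   ('k, 'l, 'g) lspace \<Rightarrow> ('k, 'l, 'e) lspace \<Rightarrow> ('g \<Rightarrow> 'e) set"
  where "lcontractive_operators sc G E = {\<phi> \<in> linear_operators G E.
    \<forall>u\<in>tensor_product sc UNIV G. lnorm E (tensor_map sc E id \<phi> u) \<le> lnorm G u}"


subsection \<open>Free L-spaces\<close>

text \<open>A functor from L-spaces to sets is given by its object part \<open>ob\<close> and its arrow part \<open>ar\<close>,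
  where \<open>ar G E \<phi>\<close> is the map \<open>ob G \<rightarrow> ob E\<close> induced by \<open>\<phi>\<close>.  The test spaces \<open>G, E\<close>
  range over all L-spaces with carrier in the type \<open>'e\<close>, which is unrelated to the type of \<open>F\<close>
  and arbitrary in the final statement.  Arrows are functions that are \<open>undefined\<close> off their domain, so
  that equality of arrows is equality of functions.\<close>

definition is_free_lspace ::
  "('k::real_or_complex \<Rightarrow> 'l::real_normed_vector \<Rightarrow> 'l) \<Rightarrow>
   (('k, 'l, 'e) lspace \<Rightarrow> 's set) \<Rightarrow>
   (('k, 'l, 'e) lspace \<Rightarrow> ('k, 'l, 'e) lspace \<Rightarrow> ('e \<Rightarrow> 'e) \<Rightarrow> 's \<Rightarrow> 's) \<Rightarrow>
   'm set \<Rightarrow> ('k, 'l, 'f) lspace \<Rightarrow> bool"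
  where "is_free_lspace sc ob ar M F \<longleftrightarrow>
    is_lspace sc F \<and>
    (\<exists>I :: ('k, 'l, 'e) lspace \<Rightarrow> ('m \<Rightarrow> 's) \<Rightarrow> 'f \<Rightarrow> 'e.
       (\<forall>E. is_lspace sc E \<longrightarrow>
          bij_betw (I E) (M \<rightarrow>\<^sub>E ob E) (lcontractive_operators sc F E)) \<and>
       (\<forall>G E. is_lspace sc G \<longrightarrow> is_lspace sc E \<longrightarrow>
          (\<forall>\<phi>\<in>lcontractive_operators sc G E. \<forall>f\<in>M \<rightarrow>\<^sub>E ob G.
             compose (carrier F) \<phi> (I G f) = I E (compose M (ar G E \<phi>) f))))"

definition odot_ob ::
  "('k::real_or_complex \<Rightarrow> 'l::real_normed_vector \<Rightarrow> 'l) \<Rightarrow> 'l set \<Rightarrow>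
   ('k, 'l, 'e) lspace \<Rightarrow> ('k, 'l, 'e) tensor set"
  where "odot_ob sc N E = {u \<in> tensor_product sc N E. lnorm E u \<le> 1}"

definition odot_ar ::
  "('k::real_or_complex \<Rightarrow> 'l::real_normed_vector \<Rightarrow> 'l) \<Rightarrow> 'l set \<Rightarrow>
   ('k, 'l, 'g) lspace \<Rightarrow> ('k, 'l, 'e) lspace \<Rightarrow> ('g \<Rightarrow> 'e) \<Rightarrow>
   ('k, 'l, 'g) tensor \<Rightarrow> ('k, 'l, 'e) tensor"
  where "odot_ar sc N G E \<phi> = restrict (tensor_map sc E id \<phi>) (odot_ob sc N G)"


subsection \<open>The minimal L-norm and the dual space\<close>

text \<open>The injective tensor norm on \<open>L \<otimes> E\<close>, for a linear space \<open>E\<close> normed by \<open>nrm\<close>: the supremum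
  of \<open>\<bar>(f \<otimes> g) u\<bar>\<close> over the unit balls of the duals of \<open>L\<close> and \<open>E\<close>.\<close>

definition injective_norm ::
  "('k::real_or_complex \<Rightarrow> 'l::real_normed_vector \<Rightarrow> 'l) \<Rightarrow> ('k, 'e, 'z) module_scheme \<Rightarrow>
   ('e \<Rightarrow> real) \<Rightarrow> ('k, 'l, 'e) tensor \<Rightarrow> real"
  where "injective_norm sc E nrm u =
    (SUP (f, g) \<in> {f. bounded_operator sc (*) f \<and> onorm f \<le> 1} \<times>
                  {g. linear_form E g \<and> (\<forall>x\<in>carrier E. norm (g x) \<le> nrm x)}.
       norm (u (\<lambda>\<xi> x. f \<xi> * g x)))"

definition minimal_lspace ::
  "('k::real_or_complex \<Rightarrow> 'l::real_normed_vector \<Rightarrow> 'l) \<Rightarrow> ('k, 'e) module \<Rightarrow>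
   ('e \<Rightarrow> real) \<Rightarrow> ('k, 'l, 'e) lspace"
  where "minimal_lspace sc E nrm = module.extend E (lspace.fields (injective_norm sc E nrm))"

text \<open>The dual of a subspace \<open>N\<close> of \<open>L\<close>: functionals on \<open>N\<close> are represented by functions that
  vanish off \<open>N\<close>.  The fields \<open>mult\<close> and \<open>one\<close> are present in every \<open>module\<close> record but play no role
  for modules.\<close>

definition dual_space ::
  "('k::real_or_complex \<Rightarrow> 'l::real_normed_vector \<Rightarrow> 'l) \<Rightarrow> 'l set \<Rightarrow> ('k, 'l \<Rightarrow> 'k) module"
  where "dual_space sc N =
    \<lparr>carrier = {f. (\<forall>\<xi>\<in>N. \<forall>\<eta>\<in>N. f (\<xi> + \<eta>) = f \<xi> + f \<eta>) \<and>
                   (\<forall>c. \<forall>\<xi>\<in>N. f (sc c \<xi>) = c * f \<xi>) \<and>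
                   (\<exists>K. \<forall>\<xi>\<in>N. norm (f \<xi>) \<le> K * norm \<xi>) \<and>
                   (\<forall>\<xi>. \<xi> \<notin> N \<longrightarrow> f \<xi> = 0)},
     mult = undefined, one = undefined,
     zero = (\<lambda>_. 0), add = (\<lambda>f g \<xi>. f \<xi> + g \<xi>),
     smult = (\<lambda>c f \<xi>. c * f \<xi>)\<rparr>"

definition dual_norm :: "'l::real_normed_vector set \<Rightarrow> ('l \<Rightarrow> 'k::real_or_complex) \<Rightarrow> real"
  where "dual_norm N f = (SUP \<xi>\<in>{\<xi> \<in> N. norm \<xi> \<le> 1}. norm (f \<xi>))"

end

(*
  Write N for the given subspace of L and P for a projection onto N with norm at most 1.  A tensor
  u in N (x) E yields the operator g |-> (g o P (x) 1) u from N^* to E, and since N is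
  finite-dimensional every linear operator phi from N^* to E arises in this way from exactly one u,
  namely the image of the identity tensor id_N in N (x) N^* under 1 (x) phi.  A tensor w in
  L (x) N^* is an operator T from N to L whose norm is, by the Hahn-Banach theorem, at most the
  injective norm of w, and the operator of u sends w to (T o P (x) 1) u.  So the L-norm axiom makes
  the operator of u contractive when u is in the unit ball.  Conversely id_N has injective norm at
  most 1, so a contractive phi gives a u in the unit ball.
*)

theory Submission imports Defs begin

subsection \<open>The Hahn-Banach theorem\<close>

text \<open>Everything about the operator of \<open>u\<close> rests on one identity,
  \<open>tensor_map_slice\<close>: applying it to the second factor of \<open>w\<close> equals
  applying \<open>T\<close> to the first factor of \<open>u\<close>. It serves three times: with
  general \<open>u\<close> and \<open>w\<close> for contractivity, with \<open>w\<close> the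
  identity tensor to recover \<open>u\<close>, and with \<open>u\<close> the identity tensor to show
  that the minimal norm is definite. The obstacle is that \<open>E\<close> has no norm of its own
  and that tensors are functionals on arbitrary bilinear forms. The value of
  \<open>f \<otimes> 1\<close> at a tensor must therefore be located in \<open>E\<close> by
  algebraic linear forms, and Zorn's lemma shows that these separate points. The projection has two
  uses: it extends functionals from \<open>N\<close> to \<open>L\<close> linearly in the functional,
  and it turns operators on \<open>N\<close> into operators on \<open>L\<close>, to which the L-norm
  axiom applies. Finite dimension enters through a finite system of vectors and bounded functionals
  that resolves the identity of \<open>N\<close>. The real scaling of the type of \<open>L\<close>
  and the scaling \<open>sc\<close> are linked only by the norm, so their compatibility
  (\<open>sc_of_real\<close>) has to precede the passage from the real to the general Hahn-Banach
  theorem.\<close>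

definition sublinear :: "('a::real_vector \<Rightarrow> real) \<Rightarrow> bool"
  where "sublinear p \<longleftrightarrow>
    (\<forall>x y. p (x + y) \<le> p x + p y) \<and> (\<forall>t x. 0 \<le> t \<longrightarrow> p (t *\<^sub>R x) = t * p x)"

lemma sublinear_add: "sublinear p \<Longrightarrow> p (x + y) \<le> p x + p y"
  and sublinear_scale: "sublinear p \<Longrightarrow> 0 \<le> t \<Longrightarrow> p (t *\<^sub>R x) = t * p x"
  by (auto simp: sublinear_def)

lemma sublinear_zero: "sublinear p \<Longrightarrow> p 0 = 0"
  using sublinear_scale[of p 0 0] by simp

lemma sublinear_minus: "sublinear p \<Longrightarrow> - p (- x) \<le> p x"
  using sublinear_add[of p x "- x"] sublinear_zero[of p] by simp

text \<open>The inequality for \<open>inverse t\<close> at the vector \<open>t x\<close> reverses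
  the inequality for \<open>t\<close> at \<open>x\<close>, so one-sided homogeneity
  suffices.\<close>

lemma sublinearI:
  assumes add: "\<And>x y. p (x + y) \<le> p x + p y"
    and zero: "p 0 = 0"
    and scale: "\<And>t x. 0 < t \<Longrightarrow> p (t *\<^sub>R x) \<le> t * p x"
  shows "sublinear p"
  unfolding sublinear_def
proof (intro conjI allI impI add)
  fix t :: real and x assume "0 \<le> t"
  show "p (t *\<^sub>R x) = t * p x"
  proof (cases "t = 0")
    case False
    with \<open>0 \<le> t\<close> have t: "0 < t" by simp
    have "p x \<le> inverse t * p (t *\<^sub>R x)"
      using scale[of "inverse t" "t *\<^sub>R x"] t by simp
    then have "t * p x \<le> p (t *\<^sub>R x)"
      using t by (simp add: field_simps)
    with scale[OF t, of x] show ?thesis by simp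
  qed (simp add: zero)
qed

lemma sublinear_norm: "sublinear norm"
  by (simp add: sublinear_def norm_triangle_ineq)

text \<open>The largest sublinear functional below \<open>p\<close> whose value at \<open>- y\<close> is at most \<open>- p y\<close>.\<close>

definition sublinear_lower :: "('a::real_vector \<Rightarrow> real) \<Rightarrow> 'a \<Rightarrow> 'a \<Rightarrow> real"
  where "sublinear_lower p y x = (INF t\<in>{0..}. p (x + t *\<^sub>R y) - t * p y)"

lemma sublinear_lower_le:
  assumes "sublinear p" "0 \<le> t"
  shows "sublinear_lower p y x \<le> p (x + t *\<^sub>R y) - t * p y"
  unfolding sublinear_lower_def
proof (rule cINF_lower)
  show "bdd_below ((\<lambda>t. p (x + t *\<^sub>R y) - t * p y) ` {0..})"
  proof (rule bdd_belowI2)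
    fix s :: real assume "s \<in> {0..}"
    \<comment> \<open>Subadditivity on \<open>s y = - x + (x + s y)\<close>. The bound does not
      involve \<open>s\<close>, which makes the infimum finite.\<close>
    then show "- p (- x) \<le> p (x + s *\<^sub>R y) - s * p y"
      using sublinear_add[OF assms(1), of "- x" "x + s *\<^sub>R y"] sublinear_scale[OF assms(1), of s y]
      by simp
  qed
qed (use assms in simp)

lemma sublinear_lower_greatest:
  assumes "\<And>t. 0 \<le> t \<Longrightarrow> b \<le> p (x + t *\<^sub>R y) - t * p y"
  shows "b \<le> sublinear_lower p y x"
  unfolding sublinear_lower_def by (rule cINF_greatest) (use assms in auto)

text \<open>Parameters add and rescale: \<open>s\<close> for \<open>x\<close> and \<open>t\<close>
  for \<open>z\<close> combine to \<open>s + t\<close> for \<open>x + z\<close>, and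
  \<open>t\<close> for \<open>x\<close> becomes \<open>c * t\<close> for \<open>c x\<close>. The
  infima over \<open>s\<close> and \<open>t\<close> are then taken one after the other.\<close>

lemma sublinear_sublinear_lower:
  assumes p: "sublinear p"
  shows "sublinear (sublinear_lower p y)"
proof (rule sublinearI)
  fix x z
  have "sublinear_lower p y (x + z) - (p (x + s *\<^sub>R y) - s * p y) \<le> p (z + t *\<^sub>R y) - t * p y"
    if "0 \<le> s" "0 \<le> t" for s t
    using sublinear_lower_le[OF p, of "s + t" y "x + z"] that
      sublinear_add[OF p, of "x + s *\<^sub>R y" "z + t *\<^sub>R y"]
    by (simp add: algebra_simps)
  then have "sublinear_lower p y (x + z) - (p (x + s *\<^sub>R y) - s * p y) \<le> sublinear_lower p y z"
    if "0 \<le> s" for s using that by (intro sublinear_lower_greatest)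
  then have "sublinear_lower p y (x + z) - sublinear_lower p y z \<le> sublinear_lower p y x"
    by (intro sublinear_lower_greatest) (simp add: algebra_simps)
  then show "sublinear_lower p y (x + z) \<le> sublinear_lower p y x + sublinear_lower p y z"
    by simp
next
  show "sublinear_lower p y 0 = 0"
    by (simp add: sublinear_lower_def sublinear_scale[OF p])
next
  fix c :: real and x assume c: "0 < c"
  have "sublinear_lower p y (c *\<^sub>R x) / c \<le> sublinear_lower p y x"
  proof (rule sublinear_lower_greatest)
    fix t :: real assume t: "0 \<le> t"
    have "sublinear_lower p y (c *\<^sub>R x) \<le> p (c *\<^sub>R (x + t *\<^sub>R y)) - c * t * p y"
      using sublinear_lower_le[OF p, of "c * t" y "c *\<^sub>R x"] c t by (simp add: algebra_simps)
    also have "\<dots> = c * (p (x + t *\<^sub>R y) - t * p y)"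
      using c by (simp only: sublinear_scale[OF p]) (simp add: algebra_simps)
    finally show "sublinear_lower p y (c *\<^sub>R x) / c \<le> p (x + t *\<^sub>R y) - t * p y"
      using c by (simp add: field_simps)
  qed
  then show "sublinear_lower p y (c *\<^sub>R x) \<le> c * sublinear_lower p y x"
    using c by (simp add: field_simps)
qed

text \<open>Subadditivity is where the chain matters: of two members \<open>p\<close> and
  \<open>r\<close>, the smaller one may be used on both summands. The infima are finite because
  \<open>p x\<close> is at least \<open>- p (- x)\<close>, hence at least
  \<open>- q (- x)\<close>.\<close>

lemma sublinear_INF_chain:
  assumes "C \<noteq> {}" and C: "\<And>p. p \<in> C \<Longrightarrow> sublinear p"
    and chain: "\<And>p r. p \<in> C \<Longrightarrow> r \<in> C \<Longrightarrow> p \<le> r \<or> r \<le> p"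
    and q: "\<And>p. p \<in> C \<Longrightarrow> p \<le> q"
  shows "sublinear (\<lambda>x. INF p\<in>C. p x)" "p \<in> C \<Longrightarrow> (\<lambda>x. INF p\<in>C. p x) \<le> p"
proof -
  have "- q (- x) \<le> p x" if "p \<in> C" for p x
    using sublinear_minus[OF C[OF that], of x] q[OF that] by (simp add: le_fun_def) (smt (verit))
  then have bdd: "bdd_below ((\<lambda>p. p x) ` C)" for x
    by (rule bdd_belowI2)
  have lower: "(INF p\<in>C. p x) \<le> p x" if "p \<in> C" for p x
    by (rule cINF_lower[OF bdd that])
  then show "(\<lambda>x. INF p\<in>C. p x) \<le> p" if "p \<in> C"
    using that by (simp add: le_fun_def)
  show "sublinear (\<lambda>x. INF p\<in>C. p x)"
  proof (rule sublinearI)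
    fix x y
    have le: "(INF p\<in>C. p (x + y)) \<le> p x + r y" if "p \<in> C" "r \<in> C" for p r
      using chain[OF that]
    proof
      assume "p \<le> r"
      then have "p y \<le> r y" by (simp add: le_fun_def)
      then show ?thesis
        using lower[OF that(1), of "x + y"] sublinear_add[OF C[OF that(1)], of x y] by simp
    next
      assume "r \<le> p"
      then have "r x \<le> p x" by (simp add: le_fun_def)
      then show ?thesis
        using lower[OF that(2), of "x + y"] sublinear_add[OF C[OF that(2)], of x y] by simp
    qed
    have "(INF p\<in>C. p (x + y)) - p x \<le> (INF r\<in>C. r y)" if "p \<in> C" for p
      using le[OF that] by (intro cINF_greatest[OF assms(1)]) (simp add: algebra_simps)
    then have "(INF p\<in>C. p (x + y)) - (INF r\<in>C. r y) \<le> (INF p\<in>C. p x)"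
      by (intro cINF_greatest[OF assms(1)]) (simp add: algebra_simps)
    then show "(INF p\<in>C. p (x + y)) \<le> (INF p\<in>C. p x) + (INF p\<in>C. p y)" by simp
  next
    have "(\<lambda>p. p 0) ` C = {0}"
      using assms(1) sublinear_zero[OF C] by (auto simp: image_iff)
    then show "(INF p\<in>C. p 0) = 0" by simp
  next
    fix t :: real and x assume t: "0 < t"
    have "(INF p\<in>C. p (t *\<^sub>R x)) / t \<le> (INF p\<in>C. p x)"
    proof (rule cINF_greatest[OF assms(1)])
      fix p assume p: "p \<in> C"
      show "(INF p\<in>C. p (t *\<^sub>R x)) / t \<le> p x"
        using lower[OF p, of "t *\<^sub>R x"] sublinear_scale[OF C[OF p], of t x] t
        by (simp add: field_simps)
    qed
    then show "(INF p\<in>C. p (t *\<^sub>R x)) \<le> t * (INF p\<in>C. p x)"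
      using t by (simp add: field_simps)
  qed
qed

lemma minimal_sublinear_below:
  assumes "sublinear q"
  obtains p where "sublinear p" "p \<le> q" "\<And>r. sublinear r \<Longrightarrow> r \<le> p \<Longrightarrow> r = p"
proof -
  define A where "A = {p. sublinear p \<and> p \<le> q}"
  have "\<exists>p\<in>A. \<forall>r\<in>A. r \<le> p \<longrightarrow> r = p"
  \<comment> \<open>The order is reversed, so upper bounds of chains are pointwise infima and the
    maximal element is a minimal functional.\<close>
  proof (rule predicate_Zorn)
    show "partial_order_on A (relation_of (\<lambda>p r. r \<le> p) A)"
      by (rule partial_order_on_relation_ofI) auto
  next
    fix C assume C: "C \<in> Chains (relation_of (\<lambda>p r. r \<le> p) A)"
    show "\<exists>r\<in>A. \<forall>p\<in>C. r \<le> p"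
    proof (cases "C = {}")
      case True
      then show ?thesis using assms by (auto simp: A_def)
    next
      case False
      have CA: "C \<subseteq> A" and chain: "\<And>p r. p \<in> C \<Longrightarrow> r \<in> C \<Longrightarrow> p \<le> r \<or> r \<le> p"
        using C by (auto simp: Chains_def relation_of_def)
      have *: "sublinear (\<lambda>x. INF p\<in>C. p x)" "\<And>p. p \<in> C \<Longrightarrow> (\<lambda>x. INF p\<in>C. p x) \<le> p"
        using sublinear_INF_chain[OF False _ chain, of q] CA by (auto simp: A_def)
      moreover obtain p where "p \<in> C" using False by auto
      ultimately have "(\<lambda>x. INF p\<in>C. p x) \<in> A"
        using CA by (auto simp: A_def intro: order.trans[OF *(2)])
      with *(2) show ?thesis by blast
    qed
  qed
  then obtain p where p: "p \<in> A" and min: "\<And>r. r \<in> A \<Longrightarrow> r \<le> p \<Longrightarrow> r = p"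
    by blast
  show thesis
  proof (rule that[of p])
    fix r assume "sublinear r" "r \<le> p"
    then show "r = p" using p by (intro min) (auto simp: A_def intro: order.trans)
  qed (use p in \<open>auto simp: A_def\<close>)
qed

text \<open>A minimal sublinear functional equals all of its lowerings, which makes it additive.\<close>

theorem linear_below_sublinear:
  assumes "sublinear q"
  obtains f where "linear f" "\<And>x. f x \<le> q x"
proof -
  obtain p where p: "sublinear p" "p \<le> q" and min: "\<And>r. sublinear r \<Longrightarrow> r \<le> p \<Longrightarrow> r = p"
    using minimal_sublinear_below[OF assms] by metis
  have lower: "sublinear_lower p y = p" for y
  proof (rule min)
    show "sublinear_lower p y \<le> p"
      using sublinear_lower_le[OF p(1), of 0 y] by (simp add: le_fun_def)
  qed (rule sublinear_sublinear_lower[OF p(1)])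
  \<comment> \<open>The parameter \<open>1\<close> in the lowering, which equals \<open>p\<close>,
    gives the superadditive half.\<close>
  have add: "p (x + y) = p x + p y" for x y
    using sublinear_lower_le[OF p(1), of 1 y x] sublinear_add[OF p(1), of x y] by (simp add: lower)
  have minus: "p (- x) = - p x" for x
    using add[of x "- x"] sublinear_zero[OF p(1)] by simp
  have "linear p"
  proof (rule linearI)
    fix c x
    show "p (c *\<^sub>R x) = c *\<^sub>R p x"
    proof (cases "0 \<le> c")
      case False
      then have "p ((- c) *\<^sub>R x) = - c * p x"
        by (intro sublinear_scale[OF p(1)]) simp
      then show ?thesis by (simp add: minus)
    qed (simp add: sublinear_scale[OF p(1)])
  qed (rule add)
  with p(2) that show thesis by (auto simp: le_fun_def)
qed

text \<open>The condition at \<xi> is built into the dominating functional, the lowering of the norm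
  along \<xi>. Parameter \<open>0\<close> keeps \<open>f\<close> below the norm; parameter
  \<open>1\<close> forces \<open>f (- \<xi>)\<close> down to \<open>- norm \<xi>\<close>.\<close>

corollary real_norming_functional:
  fixes \<xi> :: "'a::real_normed_vector"
  obtains f where "linear f" "\<And>x. f x \<le> norm x" "f \<xi> = norm \<xi>"
proof -
  obtain f where f: "linear f" "\<And>x. f x \<le> sublinear_lower norm \<xi> x"
    using linear_below_sublinear[OF sublinear_sublinear_lower[OF sublinear_norm]] by blast
  have le: "f x \<le> norm x" for x
    using f(2)[of x] sublinear_lower_le[OF sublinear_norm, of 0 \<xi> x] by simp
  have "f (- \<xi>) \<le> - norm \<xi>"
    using f(2)[of "- \<xi>"] sublinear_lower_le[OF sublinear_norm, of 1 \<xi> "- \<xi>"] by simp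
  then have "norm \<xi> \<le> f \<xi>"
    by (simp add: linear_neg[OF f(1)])
  with that f(1) le show thesis by (meson order.antisym)
qed

subsection \<open>Functionals over the scalar field\<close>

lemma linear_iff_add_scale:
  assumes "vector_space s" "vector_space t"
  shows "Vector_Spaces.linear s t f \<longleftrightarrow>
    (\<forall>x y. f (x + y) = f x + f y) \<and> (\<forall>c x. f (s c x) = t c (f x))"
  using assms
  by (simp add: Vector_Spaces.linear_def module_hom_def module_hom_axioms_def module_iff_vector_space)

lemma normed_space_mult: "normed_space ((*) :: 'k::real_or_complex \<Rightarrow> 'k \<Rightarrow> 'k)"
  by unfold_locales (simp_all add: algebra_simps norm_mult)

context normed_space
begin

lemma vector_space_sc: "vector_space sc" ..

lemma linear_functional_iff:
  "Vector_Spaces.linear sc (*) f \<longleftrightarrow>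
    (\<forall>x y. f (x + y) = f x + f y) \<and> (\<forall>c x. f (sc c x) = c * f x)"
  using vector_space_sc normed_space.vector_space_sc[OF normed_space_mult]
  by (rule linear_iff_add_scale)

lemma linear_operator_iff:
  "Vector_Spaces.linear sc sc f \<longleftrightarrow>
    (\<forall>x y. f (x + y) = f x + f y) \<and> (\<forall>c x. f (sc c x) = sc c (f x))"
  using vector_space_sc vector_space_sc by (rule linear_iff_add_scale)

text \<open>The defect \<open>d\<close> is additive, vanishes on the integers and is bounded on the unit interval.\<close>

lemma sc_of_real: "sc (of_real r) x = r *\<^sub>R x"
proof -
  define d where "d t = sc (of_real t) x - t *\<^sub>R x" for t
  have add: "d (s + t) = d s + d t" for s t
    by (simp add: d_def scale_left_distrib scaleR_left_distrib)
  have nat: "d (of_nat n * t) = of_nat n *\<^sub>R d t" for n t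
    by (induction n) (simp_all add: add distrib_right scaleR_left_distrib, simp add: d_def)
  have minus: "d (- t) = - d t" for t
    using add[of t "- t"] by (simp add: d_def)
  have one: "d 1 = 0" by (simp add: d_def)
  have int: "d (of_int k) = 0" for k
  proof (cases k)
    case (nonneg n)
    then show ?thesis using nat[of n 1] by (simp add: one)
  next
    case (neg n)
    then show ?thesis using nat[of "Suc n" 1] minus[of "of_nat (Suc n)"] by (simp add: one)
  qed
  have le: "norm (d t) \<le> 2 * norm x" if "\<bar>t\<bar> \<le> 1" for t
  proof -
    have "norm (d t) \<le> \<bar>t\<bar> * norm x + \<bar>t\<bar> * norm x"
      unfolding d_def by (rule order.trans[OF norm_triangle_ineq4]) (simp add: norm_sc)
    also have "\<dots> \<le> 1 * norm x + 1 * norm x"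
      using that by (intro add_mono mult_right_mono) auto
    finally show ?thesis by simp
  qed
  have "of_nat n * norm (d r) \<le> 2 * norm x" for n :: nat
  proof -
    define f where "f = frac (of_nat n * r)"
    have "d (of_nat n * r) = d (of_int \<lfloor>of_nat n * r\<rfloor> + f)"
      by (simp add: f_def frac_def)
    also have "\<dots> = d f" by (simp only: add int) simp
    finally have "norm (d (of_nat n * r)) \<le> 2 * norm x"
      using le[of f] frac_ge_0[of "of_nat n * r"] frac_lt_1[of "of_nat n * r"]
      by (simp add: f_def)
    then show ?thesis by (simp add: nat)
  qed
  then have "\<not> 0 < norm (d r)"
    using reals_Archimedean3[of "norm (d r)"] by (meson not_le)
  then show ?thesis by (simp add: d_def)
qed

text \<open>\<open>bounded_linear\<close> speaks of the real scaling of the types;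
  \<open>sc_of_real\<close> on both sides derives it from linearity over \<open>'k\<close>.\<close>

lemma bounded_operatorI:
  assumes t: "normed_space t" and lin: "Vector_Spaces.linear sc t a"
    and le: "\<And>x. norm (a x) \<le> K * norm x"
  shows "bounded_operator sc t a"
proof -
  have a: "\<And>x y. a (x + y) = a x + a y" "\<And>c x. a (sc c x) = t c (a x)"
    using lin linear_iff_add_scale[OF vector_space_sc normed_space.vector_space_sc[OF t]] by auto
  have "bounded_linear a"
  proof (rule bounded_linear_intro)
    fix r x
    show "a (r *\<^sub>R x) = r *\<^sub>R a x"
      using a(2)[of "of_real r" x] by (simp add: sc_of_real normed_space.sc_of_real[OF t])
    show "norm (a x) \<le> norm x * K" using le[of x] by (simp add: mult.commute)
  qed (rule a(1))
  with lin show ?thesis by (simp add: bounded_operator_def)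
qed

end

lemma real_or_complex_embedding:
  obtains h :: "'k::real_or_complex \<Rightarrow> complex" where
    "\<And>x y. h (x + y) = h x + h y" "\<And>x y. h (x * y) = h x * h y"
    "\<And>x. cmod (h x) = norm x" "\<And>r. h (of_real r) = of_real r"
    "inj h" "range h = \<real> \<or> range h = UNIV"
proof -
  obtain h :: "'k \<Rightarrow> complex" where h: "\<And>x y. h (x + y) = h x + h y"
    "\<And>x y. h (x * y) = h x * h y" "\<And>x. cmod (h x) = norm x" "range h = \<real> \<or> range h = UNIV"
    using real_or_complex by metis
  have "h 1 * h 1 = h 1 * 1" using h(2)[of 1 1] by simp
  moreover have "h 1 \<noteq> 0" using h(3)[of 1] by auto
  ultimately have one: "h 1 = 1" by simp
  \<comment> \<open>Through \<open>h\<close> the complex plane becomes a normed space over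
    \<open>'k\<close>, so \<open>sc_of_real\<close> determines \<open>h\<close> on the real
    scalars.\<close>
  have "normed_space (\<lambda>c z. h c * z)"
    by unfold_locales (simp_all add: h one algebra_simps norm_mult)
  then have "h (of_real r) * 1 = r *\<^sub>R 1" for r
    by (rule normed_space.sc_of_real)
  then have of_real: "h (of_real r) = of_real r" for r
    by (simp add: scaleR_conv_of_real)
  have "inj h"
  proof (rule injI)
    fix x y assume eq: "h x = h y"
    have "h (x - y) + h y = h x" using h(1)[of "x - y" y] by simp
    then have "norm (x - y) = 0" using h(3)[of "x - y"] eq by simp
    then show "x = y" by simp
  qed
  with h of_real that show thesis by blast
qed

context normed_space
begin

text \<open>If \<open>h\<close> has real range, every scalar is real and \<open>g\<close> is
  \<open>f\<close> itself up to \<open>of_real\<close>. Otherwise some \<open>j\<close> plays the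
  role of the imaginary unit, and \<open>g x = f x - j f (j x)\<close> is the classical
  complexification of a real functional.\<close>

lemma functional_with_real_part:
  fixes h :: "'k \<Rightarrow> complex"
  assumes h: "\<And>x y. h (x + y) = h x + h y" "\<And>x y. h (x * y) = h x * h y"
    "\<And>r. h (of_real r) = of_real r" "inj h" "range h = \<real> \<or> range h = UNIV"
    and f: "linear f"
  obtains g where "Vector_Spaces.linear sc (*) g" "\<And>x. Re (h (g x)) = f x"
  using h(5)
proof
  assume range: "range h = \<real>"
  have real: "c = of_real (Re (h c))" for c
  proof (rule injD[OF h(4)])
    have "h c \<in> \<real>" using range by auto
    then show "h c = h (of_real (Re (h c)))" by (simp add: h(3))
  qed
  have "f (sc c x) = Re (h c) * f x" for c x
    using real[of c] linear_scale[OF f, of "Re (h c)" x] by (metis real_scaleR_def sc_of_real)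
  then have "of_real (f (sc c x)) = c * of_real (f x)" for c x
    using real[of c] by (metis of_real_mult)
  then have "Vector_Spaces.linear sc (*) (\<lambda>x. of_real (f x))"
    by (simp add: linear_functional_iff linear_add[OF f])
  then show thesis by (rule that) (simp add: h(3))
next
  assume "range h = UNIV"
  then obtain j where j: "h j = \<i>" by (metis rangeE UNIV_I)
  have jj: "j * j = - 1"
  proof (rule injD[OF h(4)])
    show "h (j * j) = h (- 1)" using h(3)[of "- 1"] by (simp add: h(2) j)
  qed
  then have jjx: "j * (j * x) = - x" for x
    by (simp add: mult.assoc[symmetric])
  have decomp: "c = of_real (Re (h c)) + of_real (Im (h c)) * j" for c
  proof (rule injD[OF h(4)])
    show "h c = h (of_real (Re (h c)) + of_real (Im (h c)) * j)"
      by (simp add: h(1-3) j complex_eq_iff)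
  qed
  define g where "g x = of_real (f x) - j * of_real (f (sc j x))" for x
  have "g (sc c x) = c * g x" for c x
  proof -
    define a b where "a = Re (h c)" and "b = Im (h c)"
    have c: "c = of_real a + of_real b * j" using decomp[of c] by (simp add: a_def b_def)
    have 1: "sc c x = a *\<^sub>R x + b *\<^sub>R sc j x"
      unfolding c by (simp only: scale_left_distrib sc_of_real scale_scale[symmetric])
    have "j * c = of_real a * j + of_real (- b)"
      by (simp add: c algebra_simps jjx)
    then have 2: "sc j (sc c x) = a *\<^sub>R sc j x + (- b) *\<^sub>R x"
      by (simp only: scale_scale) (simp only: scale_left_distrib sc_of_real scale_scale[symmetric])
    have "g (sc c x) = of_real (a * f x + b * f (sc j x)) - j * of_real (a * f (sc j x) - b * f x)"
      unfolding g_def 2 unfolding 1 by (simp add: linear_add[OF f] linear_diff[OF f] linear_scale[OF f])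
    also have "\<dots> = of_real a * of_real (f x) + of_real b * of_real (f (sc j x))
        - of_real a * j * of_real (f (sc j x)) + of_real b * j * of_real (f x)"
      by (simp add: algebra_simps)
    also have "\<dots> = of_real a * of_real (f x) - (j * j) * of_real b * of_real (f (sc j x))
        - of_real a * j * of_real (f (sc j x)) + of_real b * j * of_real (f x)"
      by (simp add: jj)
    also have "\<dots> = c * g x"
      unfolding c g_def by (simp add: algebra_simps)
    finally show ?thesis .
  qed
  moreover have "g (x + y) = g x + g y" for x y
    unfolding g_def scale_right_distrib linear_add[OF f] by (simp add: algebra_simps)
  ultimately have "Vector_Spaces.linear sc (*) g"
    by (simp add: linear_functional_iff)
  then show thesis
  proof (rule that)
    fix x
    have "of_real (f x) = g x + j * of_real (f (sc j x))" by (simp add: g_def)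
    then have "of_real (f x) = h (g x) + \<i> * of_real (f (sc j x))"
      by (metis h(1-3) j)
    then show "Re (h (g x)) = f x" by (simp add: complex_eq_iff)
  qed
qed

text \<open>The real norming functional becomes the real part of \<open>g\<close>. Since the modulus
  dominates the real part, the norm is still attained at \<xi>; only the upper bound needs a
  rotation.\<close>

theorem norming_functional:
  "\<exists>g. bounded_operator sc (*) g \<and> (\<forall>x. norm (g x) \<le> norm x) \<and> norm (g \<xi>) = norm \<xi>"
proof -
  obtain h :: "'k \<Rightarrow> complex" where h: "\<And>x y. h (x + y) = h x + h y" "\<And>x y. h (x * y) = h x * h y"
    "\<And>x. cmod (h x) = norm x" "\<And>r. h (of_real r) = of_real r" "inj h" "range h = \<real> \<or> range h = UNIV"
    using real_or_complex_embedding by metis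
  obtain f where f: "linear f" "\<And>x. f x \<le> norm x" "f \<xi> = norm \<xi>"
    using real_norming_functional by metis
  obtain g where g: "Vector_Spaces.linear sc (*) g" "\<And>x. Re (h (g x)) = f x"
    using functional_with_real_part[OF h(1,2,4-6) f(1)] by metis
  have le: "norm (g x) \<le> norm x" for x
  proof (cases "g x = 0")
    case False
    \<comment> \<open>A scalar of modulus one that rotates \<open>g x\<close> to a nonnegative real,
      where \<open>g\<close> and its real part \<open>f\<close> have the same value.\<close>
    define c where "c = of_real (norm (g x)) / g x"
    have "g (sc c x) = of_real (norm (g x))"
      using g(1) False by (simp add: linear_functional_iff c_def)
    then have "norm (g x) = f (sc c x)"
      using g(2)[of "sc c x"] by (simp add: h(4))
    also have "\<dots> \<le> norm x"
      using f(2)[of "sc c x"] False by (simp add: norm_sc c_def norm_divide)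
    finally show ?thesis .
  qed simp
  have "norm \<xi> \<le> cmod (h (g \<xi>))"
    using complex_Re_le_cmod[of "h (g \<xi>)"] by (simp add: g(2) f(3))
  then have "norm (g \<xi>) = norm \<xi>" using le[of \<xi>] by (simp add: h(3))
  moreover have "bounded_operator sc (*) g"
    using bounded_operatorI[OF normed_space_mult g(1), of 1] le by simp
  ultimately show ?thesis using le by auto
qed

corollary functionals_separate_points:
  assumes "\<And>f. bounded_operator sc (*) f \<Longrightarrow> f \<xi> = f \<eta>"
  shows "\<xi> = \<eta>"
proof -
  obtain g where g: "bounded_operator sc (*) g" "norm (g (\<xi> - \<eta>)) = norm (\<xi> - \<eta>)"
    using norming_functional[of "\<xi> - \<eta>"] by blast
  then have "linear g" by (simp add: bounded_operator_def bounded_linear.linear)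
  then have "g (\<xi> - \<eta>) = 0"
    using Real_Vector_Spaces.linear_diff[of g \<xi> \<eta>] assms[OF g(1)] by simp
  with g(2) show ?thesis by simp
qed

text \<open>A resolution of the identity of the span by bounded functionals. A generator
  \<open>w\<close> is split off with a functional \<open>f\<close>, \<open>f w = 1\<close>, and the
  projection \<open>q\<close> along \<open>w\<close> onto the kernel of \<open>f\<close>. The
  induction is on the cardinality because the hypothesis is applied to the image of
  \<open>B'\<close> under \<open>q\<close>, not to a subset of \<open>B\<close>.\<close>

lemma span_dual_system:
  assumes "finite B"
  shows "\<exists>n v g. (\<forall>i<n::nat. v i \<in> span B \<and> bounded_operator sc (*) (g i)) \<and>
    (\<forall>\<xi>\<in>span B. (\<Sum>i<n. sc (g i \<xi>) (v i)) = \<xi>)"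
  using assms
proof (induction "card B" arbitrary: B rule: less_induct)
  case less
  show ?case
  proof (cases "B = {}")
    case True
    then show ?thesis by (intro exI[of _ 0]) simp
  next
    case False
    then obtain w B' where B: "B = insert w B'" "w \<notin> B'"
      by (meson all_not_in_conv mk_disjoint_insert)
    have fin: "finite B'" and card: "card B' < card B" using less.prems B by auto
    show ?thesis
    proof (cases "w = 0")
      case True
      then have "span B = span B'" by (simp add: B span_insert_0)
      then show ?thesis using less.hyps[OF card fin] by simp
    next
      case False
      obtain f0 where f0: "bounded_operator sc (*) f0" "norm (f0 w) = norm w"
        using norming_functional[of w] by blast
      then have "f0 w \<noteq> 0" using False by auto
      define f where "f x = f0 x * inverse (f0 w)" for x
      have f: "bounded_operator sc (*) f"
        using f0(1) unfolding bounded_operator_def linear_functional_iff f_def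
        by (simp add: bounded_linear_mult_const algebra_simps)
      have f_add: "\<And>x y. f (x + y) = f x + f y" and f_sc: "\<And>c x. f (sc c x) = c * f x"
        and bl: "bounded_linear f"
        using f by (auto simp: bounded_operator_def linear_functional_iff)
      have fw: "f w = 1" using \<open>f0 w \<noteq> 0\<close> by (simp add: f_def)
      define q where "q x = x - sc (f x) w" for x
      have q_add: "q (x + y) = q x + q y" and q_sc: "q (sc c x) = sc c (q x)" for x y c
        by (simp_all add: q_def f_add f_sc scale_left_distrib scale_right_diff_distrib)
      have le: "norm (q x) \<le> (1 + onorm f * norm w) * norm x" for x
        using norm_triangle_ineq4[of x "sc (f x) w"] mult_right_mono[OF onorm[OF bl, of x], of "norm w"]
        by (simp add: q_def norm_sc algebra_simps)
      have "Vector_Spaces.linear sc sc q"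
        by (simp add: linear_operator_iff q_add q_sc)
      then have q: "bounded_operator sc sc q"
        using bounded_operatorI[OF normed_space_axioms _ le] by simp
      have "card (q ` B') < card B"
        using card card_image_le[OF fin, of q] by simp
      note less.hyps[OF this finite_imageI[OF fin]]
      then obtain n :: nat and v :: "nat \<Rightarrow> 'l" and g :: "nat \<Rightarrow> 'l \<Rightarrow> 'k" where
        vg: "\<forall>i<n. v i \<in> span (q ` B') \<and> bounded_operator sc (*) (g i)"
        and sum: "\<forall>\<xi>\<in>span (q ` B'). (\<Sum>i<n. sc (g i \<xi>) (v i)) = \<xi>"
        by (elim exE conjE)
      have "q ` B' \<subseteq> span B"
        by (auto simp: q_def B intro!: span_diff span_scale intro: span_base)
      then have sub: "span (q ` B') \<subseteq> span B" by (simp add: span_minimal)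
      \<comment> \<open>Since \<open>q w = 0\<close>, only the generators in \<open>B'\<close>
        contribute to the image under \<open>q\<close>.\<close>
      have "span B \<subseteq> {x. q x \<in> span (q ` B')}"
      proof (rule span_minimal)
        show "B \<subseteq> {x. q x \<in> span (q ` B')}"
          by (auto simp: B fw q_def[of w] span_zero intro: span_base)
        show "subspace {x. q x \<in> span (q ` B')}"
          using q_sc[of 0 0] by (auto simp: subspace_def q_add q_sc span_zero intro: span_add span_scale)
      qed
      then have qsum: "(\<Sum>i<n. sc (g i (q \<xi>)) (v i)) = q \<xi>" if "\<xi> \<in> span B" for \<xi>
        using that sum by blast
      \<comment> \<open>The new index \<open>n\<close> carries the pair \<open>w\<close>,
        \<open>f\<close>, which turns the resolution of \<open>q \<xi>\<close> into one of
        \<open>\<xi> = q \<xi> + f \<xi> w\<close>; the old functionals are composed with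
        \<open>q\<close>.\<close>
      define v' where "v' i = (if i < n then v i else w)" for i
      define g' where "g' i = (if i < n then (\<lambda>\<xi>. g i (q \<xi>)) else f)" for i
      have "(\<Sum>i<Suc n. sc (g' i \<xi>) (v' i)) = \<xi>" if "\<xi> \<in> span B" for \<xi>
        using qsum[OF that] by (simp add: v'_def g'_def) (simp add: q_def)
      moreover have "bounded_operator sc (*) (\<lambda>\<xi>. g i (q \<xi>))" if "i < n" for i
      proof -
        have "bounded_operator sc (*) (g i)" using vg that by blast
        then show ?thesis
          using q bounded_linear_compose[of "g i" q]
          by (simp add: bounded_operator_def linear_functional_iff linear_operator_iff)
      qed
      then have "bounded_operator sc (*) (g' i)" for i
        using f by (simp add: g'_def)
      moreover have "v' i \<in> span B" for i
        using vg sub by (auto simp: v'_def B intro: span_base)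
      ultimately show ?thesis by blast
    qed
  qed
qed

end

subsection \<open>Linear spaces and linear forms\<close>

lemma scalar_ring_simps [simp]:
  "carrier scalar_ring = UNIV" "\<one>\<^bsub>scalar_ring\<^esub> = 1" "\<zero>\<^bsub>scalar_ring\<^esub> = 0"
  "a \<otimes>\<^bsub>scalar_ring\<^esub> b = a * b" "a \<oplus>\<^bsub>scalar_ring\<^esub> b = a + b"
  by (simp_all add: scalar_ring_def)

lemma cring_scalar_ring: "cring scalar_ring"
proof (rule cringI)
  show "abelian_group scalar_ring"
    by (rule abelian_groupI) (auto simp: algebra_simps intro: exI[of _ "- x" for x])
  show "comm_monoid scalar_ring"
    by (rule comm_monoidI) (auto simp: algebra_simps)
qed (simp add: algebra_simps)

lemma linear_spaceI:
  fixes E (structure)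
  assumes closed: "\<zero> \<in> carrier E" "\<And>x y. x \<in> carrier E \<Longrightarrow> y \<in> carrier E \<Longrightarrow> x \<oplus> y \<in> carrier E"
      "\<And>c x. x \<in> carrier E \<Longrightarrow> c \<odot> x \<in> carrier E"
    and add: "\<And>x y z. x \<in> carrier E \<Longrightarrow> y \<in> carrier E \<Longrightarrow> z \<in> carrier E \<Longrightarrow> x \<oplus> y \<oplus> z = x \<oplus> (y \<oplus> z)"
      "\<And>x y. x \<in> carrier E \<Longrightarrow> y \<in> carrier E \<Longrightarrow> x \<oplus> y = y \<oplus> x"
      "\<And>x. x \<in> carrier E \<Longrightarrow> \<zero> \<oplus> x = x"
    and smult: "\<And>a x y. x \<in> carrier E \<Longrightarrow> y \<in> carrier E \<Longrightarrow> a \<odot> (x \<oplus> y) = a \<odot> x \<oplus> a \<odot> y"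
      "\<And>a b x. x \<in> carrier E \<Longrightarrow> (a + b) \<odot> x = a \<odot> x \<oplus> b \<odot> x"
      "\<And>a b x. x \<in> carrier E \<Longrightarrow> (a * b) \<odot> x = a \<odot> (b \<odot> x)"
      "\<And>x. x \<in> carrier E \<Longrightarrow> 1 \<odot> x = x" "\<And>x. x \<in> carrier E \<Longrightarrow> 0 \<odot> x = \<zero>"
  shows "linear_space E"
proof (rule moduleI)
  show "abelian_group E"
  proof (rule abelian_groupI)
    fix x assume x: "x \<in> carrier E"
    have "(- 1) \<odot> x \<oplus> x = ((- 1) + 1) \<odot> x"
      by (simp only: smult(2)[OF x] smult(4)[OF x])
    then show "\<exists>y\<in>carrier E. y \<oplus> x = \<zero>"
      using closed(3)[OF x, of "- 1"] smult(5)[OF x] by auto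
  qed (fact closed add)+
qed (simp_all add: cring_scalar_ring closed smult)

context
  fixes E (structure)
  assumes E: "linear_space E"
begin

interpretation Module.module scalar_ring E by (rule E)

lemma linear_space_closed:
  "\<zero> \<in> carrier E"
  "x \<in> carrier E \<Longrightarrow> y \<in> carrier E \<Longrightarrow> x \<oplus> y \<in> carrier E"
  "x \<in> carrier E \<Longrightarrow> c \<odot> x \<in> carrier E"
  using smult_closed by auto

lemma linear_space_ac:
  assumes "x \<in> carrier E" "y \<in> carrier E" "z \<in> carrier E"
  shows "x \<oplus> y \<oplus> z = x \<oplus> (y \<oplus> z)" "x \<oplus> y = y \<oplus> x" "x \<oplus> (y \<oplus> z) = y \<oplus> (x \<oplus> z)"
  using assms by (simp_all add: M.a_ac)

lemma linear_space_smult: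
  assumes "x \<in> carrier E" "y \<in> carrier E"
  shows "a \<odot> (x \<oplus> y) = a \<odot> x \<oplus> a \<odot> y" "(a + b) \<odot> x = a \<odot> x \<oplus> b \<odot> x"
    "a \<odot> (b \<odot> x) = (a * b) \<odot> x" "1 \<odot> x = x" "0 \<odot> x = \<zero>" "x \<oplus> \<zero> = x" "\<zero> \<oplus> x = x" "a \<odot> \<zero> = \<zero>"
  using assms smult_r_distr[of a x y] smult_l_distr[of a b x] smult_assoc1[of a b x] smult_one[of x]
    smult_l_null[of x] smult_r_null[of a] by auto

lemma linear_form_zero:
  assumes "linear_form E k"
  shows "k \<zero> = 0"
proof -
  have "k (0 \<odot> \<zero>) = 0 * k \<zero>"
    using assms linear_space_closed(1) unfolding linear_form_def by blast
  then show ?thesis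
    using linear_space_closed(1) by (simp add: linear_space_smult)
qed

text \<open>A subspace that is maximal among those avoiding \<open>x\<close> is the kernel of the required form.\<close>

lemma linear_form_separating:
  assumes x: "x \<in> carrier E" "x \<noteq> \<zero>"
  shows "\<exists>g. linear_form E g \<and> g x = 1"
proof -
  define S where "S = {W. W \<subseteq> carrier E \<and> \<zero> \<in> W \<and> (\<forall>y\<in>W. \<forall>z\<in>W. y \<oplus> z \<in> W) \<and>
    (\<forall>c. \<forall>y\<in>W. c \<odot> y \<in> W) \<and> x \<notin> W}"
  have "\<exists>M\<in>S. \<forall>X\<in>S. M \<subseteq> X \<longrightarrow> X = M"
  proof (rule subset_Zorn_nonempty)
    have "{\<zero>} \<in> S"
      using x linear_space_closed by (simp add: S_def linear_space_smult)
    then show "S \<noteq> {}" by blast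
  next
    fix C assume "C \<noteq> {}" and C: "subset.chain S C"
    have "C \<subseteq> S" using C by (simp add: subset.chain_def)
    have "y \<oplus> z \<in> \<Union>C" if y: "y \<in> \<Union>C" and z: "z \<in> \<Union>C" for y z
    proof -
      obtain Y Z where YZ: "Y \<in> C" "Z \<in> C" "y \<in> Y" "z \<in> Z"
        using y z by (elim UnionE)
      then have "Y \<subseteq> Z \<or> Z \<subseteq> Y" using C by (simp add: subset_chain_def)
      then obtain W where "W \<in> C" "y \<in> W" "z \<in> W" using YZ by blast
      moreover from this have "W \<in> S" using \<open>C \<subseteq> S\<close> by blast
      ultimately show ?thesis by (auto simp: S_def)
    qed
    moreover have "\<zero> \<in> \<Union>C" using \<open>C \<noteq> {}\<close> \<open>C \<subseteq> S\<close> by (auto simp: S_def)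
    moreover have "c \<odot> y \<in> \<Union>C" if "y \<in> \<Union>C" for c y
      using that \<open>C \<subseteq> S\<close> unfolding S_def by blast
    moreover have "\<Union>C \<subseteq> carrier E" "x \<notin> \<Union>C" using \<open>C \<subseteq> S\<close> by (auto simp: S_def)
    ultimately show "\<Union>C \<in> S" unfolding S_def by blast
  qed
  then obtain M where M: "M \<in> S" and max: "\<And>X. X \<in> S \<Longrightarrow> M \<subseteq> X \<Longrightarrow> X = M" by blast
  have sub: "M \<subseteq> carrier E" and zero: "\<zero> \<in> M" and add: "\<And>y z. y \<in> M \<Longrightarrow> z \<in> M \<Longrightarrow> y \<oplus> z \<in> M"
    and scale: "\<And>c y. y \<in> M \<Longrightarrow> c \<odot> y \<in> M" and xM: "x \<notin> M"
    using M by (auto simp: S_def)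
  note closed = linear_space_closed x(1)
  \<comment> \<open>\<open>M\<close> is a complement of the line through \<open>x\<close>. The sum
    \<open>M'\<close> of \<open>M\<close> and the line through \<open>y\<close> either contains
    \<open>x\<close>, and solving for \<open>y\<close> gives \<open>c\<close>, or equals
    \<open>M\<close> by maximality, and then \<open>c = 0\<close> works.\<close>
  have ex: "\<exists>c. y \<oplus> (- c) \<odot> x \<in> M" if y: "y \<in> carrier E" for y
  proof -
    define M' where "M' = {w \<oplus> a \<odot> y | w a. w \<in> M}"
    have M'I: "w \<oplus> a \<odot> y \<in> M'" if "w \<in> M" for w a using that by (auto simp: M'_def)
    have MM': "w \<in> M'" if "w \<in> M" for w
      using M'I[OF that, of 0] that y sub by (auto simp: linear_space_smult)
    show ?thesis
    proof (cases "x \<in> M'")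
      case True
      then obtain w a where w: "w \<in> M" "x = w \<oplus> a \<odot> y" by (auto simp: M'_def)
      have wE: "w \<in> carrier E" using w sub by auto
      have a: "a \<noteq> 0"
        using w xM y wE by (auto simp: linear_space_smult)
      have "y \<oplus> (- (1 / a)) \<odot> x = y \<oplus> ((- (1 / a)) \<odot> w \<oplus> (- 1) \<odot> y)"
        unfolding w(2) using wE y a closed by (simp add: linear_space_smult)
      also have "\<dots> = (- (1 / a)) \<odot> w \<oplus> (1 \<odot> y \<oplus> (- 1) \<odot> y)"
        using wE y closed by (simp add: linear_space_ac linear_space_smult(4))
      also have "\<dots> = (- (1 / a)) \<odot> w"
        using wE y closed by (simp add: linear_space_smult(2)[symmetric]) (simp add: linear_space_smult)
      finally show ?thesis using scale[OF w(1)] by metis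
    next
      case False
      have "M' \<in> S"
        unfolding S_def
      proof (intro CollectI conjI ballI allI)
        show "M' \<subseteq> carrier E" using sub y closed by (auto simp: M'_def)
        show "\<zero> \<in> M'" using MM' zero by blast
        show "x \<notin> M'" by (rule False)
      next
        fix u v assume "u \<in> M'" "v \<in> M'"
        then obtain w a w' a' where *: "u = w \<oplus> a \<odot> y" "v = w' \<oplus> a' \<odot> y" "w \<in> M" "w' \<in> M"
          by (auto simp: M'_def)
        then have "u \<oplus> v = (w \<oplus> w') \<oplus> (a + a') \<odot> y"
          using y sub closed by (simp add: subset_iff linear_space_ac linear_space_smult(2))
        then show "u \<oplus> v \<in> M'" using M'I add * by simp
      next
        fix c u assume "u \<in> M'"
        then obtain w a where *: "u = w \<oplus> a \<odot> y" "w \<in> M" by (auto simp: M'_def)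
        then have "c \<odot> u = c \<odot> w \<oplus> (c * a) \<odot> y"
          using y sub closed by (simp add: subset_iff linear_space_smult)
        then show "c \<odot> u \<in> M'" using M'I scale * by simp
      qed
      moreover have "M \<subseteq> M'" using MM' by blast
      ultimately have "M' = M" by (rule max)
      moreover have "y \<in> M'" using M'I[OF zero, of 1] y closed by (simp add: linear_space_smult)
      ultimately have "y \<oplus> (- 0) \<odot> x \<in> M" using y closed by (simp add: linear_space_smult)
      then show ?thesis by blast
    qed
  qed
  define g where "g y = (SOME c. y \<oplus> (- c) \<odot> x \<in> M)" for y
  have g: "y \<oplus> (- g y) \<odot> x \<in> M" if "y \<in> carrier E" for y
    unfolding g_def by (rule someI_ex[OF ex[OF that]])
  \<comment> \<open>Two different coefficients would put a nonzero multiple of \<open>x\<close> into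
    \<open>M\<close>. Linearity of \<open>g\<close> follows from this uniqueness.\<close>
  have unique: "c = g y" if y: "y \<in> carrier E" and c: "y \<oplus> (- c) \<odot> x \<in> M" for c y
  proof (rule ccontr)
    assume "c \<noteq> g y"
    have "(y \<oplus> (- c) \<odot> x) \<oplus> (- 1) \<odot> (y \<oplus> (- g y) \<odot> x)
        = (y \<oplus> (- c) \<odot> x) \<oplus> ((- 1) \<odot> y \<oplus> g y \<odot> x)"
      using y closed by (simp add: linear_space_smult)
    also have "\<dots> = (1 \<odot> y \<oplus> (- 1) \<odot> y) \<oplus> (g y \<odot> x \<oplus> (- c) \<odot> x)"
      using y closed by (simp add: linear_space_ac linear_space_smult(4))
    also have "\<dots> = (g y - c) \<odot> x"
      using y closed by (simp add: linear_space_smult(2)[symmetric]) (simp add: linear_space_smult)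
    finally have "(g y - c) \<odot> x \<in> M"
      using add[OF c scale[OF g[OF y], of "- 1"]] by simp
    then have "(1 / (g y - c)) \<odot> ((g y - c) \<odot> x) \<in> M" by (rule scale)
    then show False using \<open>c \<noteq> g y\<close> xM closed by (simp add: linear_space_smult)
  qed
  have "linear_form E g"
    unfolding linear_form_def
  proof (intro conjI ballI allI)
    fix y z assume y: "y \<in> carrier E" and z: "z \<in> carrier E"
    have "(y \<oplus> z) \<oplus> (- (g y + g z)) \<odot> x = (y \<oplus> z) \<oplus> ((- g y) \<odot> x \<oplus> (- g z) \<odot> x)"
      using closed by (simp add: linear_space_smult(2)[symmetric])
    also have "\<dots> = (y \<oplus> (- g y) \<odot> x) \<oplus> (z \<oplus> (- g z) \<odot> x)"
      using y z closed by (simp add: linear_space_ac)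
    also have "\<dots> \<in> M" using g y z add by simp
    finally show "g (y \<oplus> z) = g y + g z"
      using unique[of "y \<oplus> z"] y z closed by metis
  next
    fix c y assume y: "y \<in> carrier E"
    have "(c \<odot> y) \<oplus> (- (c * g y)) \<odot> x = c \<odot> (y \<oplus> (- g y) \<odot> x)"
      using y closed by (simp add: linear_space_smult)
    also have "\<dots> \<in> M" using g y scale by simp
    finally show "g (c \<odot> y) = c * g y"
      using unique[of "c \<odot> y"] y closed by metis
  qed
  moreover have "x \<oplus> (- 1) \<odot> x = (1 + - 1) \<odot> x"
    using closed by (simp only: linear_space_smult(2)) (simp add: linear_space_smult(4))
  then have "x \<oplus> (- 1) \<odot> x \<in> M"
    using closed zero by (simp add: linear_space_smult)
  then have "1 = g x" using x unique by simp
  ultimately show ?thesis by auto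
qed

text \<open>A separating form for the difference \<open>x - y\<close>. This is the uniqueness behind
  the description of slices by their values under linear forms.\<close>

lemma linear_form_eqI:
  assumes x: "x \<in> carrier E" and y: "y \<in> carrier E"
    and eq: "\<And>k. linear_form E k \<Longrightarrow> k x = k y"
  shows "x = y"
proof (rule ccontr)
  assume "x \<noteq> y"
  define z where "z = x \<oplus> (- 1) \<odot> y"
  have z: "z \<in> carrier E" using x y linear_space_closed by (simp add: z_def)
  have "z \<oplus> y = x \<oplus> ((- 1) \<odot> y \<oplus> 1 \<odot> y)"
    unfolding z_def using x y linear_space_closed by (simp add: linear_space_ac linear_space_smult(4))
  also have "\<dots> = x"
    using x y by (simp add: linear_space_smult(2)[symmetric]) (simp add: linear_space_smult)
  finally have "z \<noteq> \<zero>" using \<open>x \<noteq> y\<close> y by (auto simp: linear_space_smult)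
  then obtain k where k: "linear_form E k" "k z = 1"
    using linear_form_separating z by blast
  then have "k z = k x - k y"
    using x y linear_space_closed by (simp add: z_def linear_form_def)
  with eq[OF k(1)] k(2) show False by simp
qed

end

subsection \<open>Tensors\<close>

text \<open>Unlike \<open>linear_operators\<close>, this imposes no value off the carrier, so that
  \<open>id\<close> and unrestricted lambda terms qualify.\<close>

definition linear_map ::
  "('k::real_or_complex, 'g, 'y) module_scheme \<Rightarrow> ('k, 'e, 'z) module_scheme \<Rightarrow> ('g \<Rightarrow> 'e) \<Rightarrow> bool"
  where "linear_map G E \<phi> \<longleftrightarrow> \<phi> \<in> carrier G \<rightarrow> carrier E \<and>
    (\<forall>x\<in>carrier G. \<forall>y\<in>carrier G. \<phi> (x \<oplus>\<^bsub>G\<^esub> y) = \<phi> x \<oplus>\<^bsub>E\<^esub> \<phi> y) \<and>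
    (\<forall>c. \<forall>x\<in>carrier G. \<phi> (c \<odot>\<^bsub>G\<^esub> x) = c \<odot>\<^bsub>E\<^esub> \<phi> x)"

lemma linear_map_id: "linear_map E E id"
  by (simp add: linear_map_def)

lemma linear_operators_imp_linear_map: "\<phi> \<in> linear_operators G E \<Longrightarrow> linear_map G E \<phi>"
  by (auto simp: linear_operators_def linear_map_def)

lemma linear_form_compose:
  "linear_map G E \<phi> \<Longrightarrow> linear_form E k \<Longrightarrow> linear_form G (\<lambda>x. k (\<phi> x))"
  by (auto simp: linear_map_def linear_form_def Pi_iff)

context normed_space
begin

lemma bilinear_forms_iff:
  "B \<in> bilinear_forms sc E \<longleftrightarrow>
    (\<forall>x\<in>carrier E. (\<forall>\<xi> \<eta>. B (\<xi> + \<eta>) x = B \<xi> x + B \<eta> x) \<and> (\<forall>c \<xi>. B (sc c \<xi>) x = c * B \<xi> x)) \<and>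
    (\<forall>\<xi>. linear_form E (B \<xi>))"
  by (simp add: bilinear_forms_def linear_functional_iff)

lemma bilinear_forms_add:
  "B \<in> bilinear_forms sc E \<Longrightarrow> C \<in> bilinear_forms sc E \<Longrightarrow>
    (\<lambda>\<xi> x. B \<xi> x + C \<xi> x) \<in> bilinear_forms sc E"
  by (simp add: bilinear_forms_iff linear_form_def algebra_simps)

lemma bilinear_forms_scale:
  "B \<in> bilinear_forms sc E \<Longrightarrow> (\<lambda>\<xi> x. c * B \<xi> x) \<in> bilinear_forms sc E"
  by (simp add: bilinear_forms_iff linear_form_def algebra_simps)

lemma bilinear_forms_product:
  "Vector_Spaces.linear sc (*) f \<Longrightarrow> linear_form E k \<Longrightarrow>
    (\<lambda>\<xi> x. f \<xi> * k x) \<in> bilinear_forms sc E"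
  by (simp add: bilinear_forms_iff linear_functional_iff linear_form_def algebra_simps)

lemma bilinear_forms_compose:
  "Vector_Spaces.linear sc sc a \<Longrightarrow> linear_map G E \<phi> \<Longrightarrow> B \<in> bilinear_forms sc E \<Longrightarrow>
    (\<lambda>\<xi> x. B (a \<xi>) (\<phi> x)) \<in> bilinear_forms sc G"
  by (auto simp: bilinear_forms_iff linear_operator_iff linear_map_def linear_form_def Pi_iff)

lemma linear_form_bilinear: "B \<in> bilinear_forms sc E \<Longrightarrow> linear_form E (B \<xi>)"
  by (simp add: bilinear_forms_def)

lemma linear_functional_bilinear:
  "B \<in> bilinear_forms sc E \<Longrightarrow> x \<in> carrier E \<Longrightarrow> Vector_Spaces.linear sc (*) (\<lambda>\<xi>. B \<xi> x)"
  by (simp add: bilinear_forms_def)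

end

lemma zero_in_tensor_product: "(\<lambda>_. 0) \<in> tensor_product sc N E"
  unfolding tensor_product_def by (auto intro: exI[of _ 0])

lemma tensor_product_add_elementary:
  assumes "u \<in> tensor_product sc N E" "\<xi> \<in> N" "x \<in> carrier E"
  shows "(\<lambda>B. u B + elementary_tensor sc E \<xi> x B) \<in> tensor_product sc N E"
proof -
  obtain n :: nat and \<eta> y where u: "u = (\<lambda>B. \<Sum>i<n. elementary_tensor sc E (\<eta> i) (y i) B)"
    and N: "\<forall>i<n. \<eta> i \<in> N \<and> y i \<in> carrier E"
    using assms(1) unfolding tensor_product_def by blast
  have "(\<lambda>B. u B + elementary_tensor sc E \<xi> x B)
      = (\<lambda>B. \<Sum>i<Suc n. elementary_tensor sc E ((\<eta>(n := \<xi>)) i) ((y(n := x)) i) B)"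
    by (simp add: u)
  moreover have "\<forall>i<Suc n. (\<eta>(n := \<xi>)) i \<in> N \<and> (y(n := x)) i \<in> carrier E"
    using N assms(2,3) by (simp add: less_Suc_eq)
  ultimately show ?thesis unfolding tensor_product_def by blast
qed

lemma tensor_product_induct [consumes 1, case_names zero add]:
  assumes "u \<in> tensor_product sc N E"
    and zero: "Q (\<lambda>_. 0)"
    and add: "\<And>v \<xi> x. v \<in> tensor_product sc N E \<Longrightarrow> \<xi> \<in> N \<Longrightarrow> x \<in> carrier E \<Longrightarrow> Q v \<Longrightarrow>
      Q (\<lambda>B. v B + elementary_tensor sc E \<xi> x B)"
  shows "Q u"
proof -
  obtain n :: nat and \<eta> y where u: "u = (\<lambda>B. \<Sum>i<n. elementary_tensor sc E (\<eta> i) (y i) B)"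
    and N: "\<forall>i<n. \<eta> i \<in> N \<and> y i \<in> carrier E"
    using assms(1) unfolding tensor_product_def by blast
  have "Q (\<lambda>B. \<Sum>i<m. elementary_tensor sc E (\<eta> i) (y i) B)" if "m \<le> n" for m
    using that
  proof (induction m)
    case (Suc m)
    have "(\<lambda>B. \<Sum>i<m. elementary_tensor sc E (\<eta> i) (y i) B) \<in> tensor_product sc N E"
      using N Suc.prems unfolding tensor_product_def
      by (intro CollectI exI[of _ m] exI[of _ \<eta>] exI[of _ y] conjI refl) auto
    then show ?case
      using add[of _ "\<eta> m" "y m"] Suc N by simp
  qed (simp add: zero)
  then show ?thesis by (simp add: u)
qed

lemma tensor_product_mono: "N \<subseteq> M \<Longrightarrow> tensor_product sc N E \<subseteq> tensor_product sc M E"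
  unfolding tensor_product_def by blast

lemma tensor_form_off:
  "u \<in> tensor_product sc N E \<Longrightarrow> B \<notin> bilinear_forms sc E \<Longrightarrow> u B = 0"
  by (induction rule: tensor_product_induct) (simp_all add: elementary_tensor_def)

text \<open>Bilinear forms are functions on whole types, while a tensor sees them only on
  \<open>N\<close> and the carrier. This licenses rewriting under a tensor with equations that hold
  only there.\<close>

lemma tensor_form_cong:
  assumes "u \<in> tensor_product sc N E" "B \<in> bilinear_forms sc E" "C \<in> bilinear_forms sc E"
    and "\<And>\<xi> x. \<xi> \<in> N \<Longrightarrow> x \<in> carrier E \<Longrightarrow> B \<xi> x = C \<xi> x"
  shows "u B = u C"
  using assms by (induction rule: tensor_product_induct) (simp_all add: elementary_tensor_def)

context normed_space
begin

lemma tensor_form_add: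
  assumes "u \<in> tensor_product sc N E" "B \<in> bilinear_forms sc E" "C \<in> bilinear_forms sc E"
  shows "u (\<lambda>\<xi> x. B \<xi> x + C \<xi> x) = u B + u C"
  using assms(1)
  by (induction rule: tensor_product_induct)
    (simp_all add: elementary_tensor_def assms bilinear_forms_add algebra_simps)

lemma tensor_product_scale:
  assumes E: "linear_space E" and "u \<in> tensor_product sc N E"
  shows "(\<lambda>B. c * u B) \<in> tensor_product sc N E"
  using assms(2)
proof (induction rule: tensor_product_induct)
  case (add v \<xi> x)
  have "c * elementary_tensor sc E \<xi> x B = elementary_tensor sc E \<xi> (c \<odot>\<^bsub>E\<^esub> x) B" for B
    using add.hyps by (simp add: elementary_tensor_def bilinear_forms_iff linear_form_def)
  then show ?case
    using tensor_product_add_elementary[OF add.IH add.hyps(2), of "c \<odot>\<^bsub>E\<^esub> x"] add.hyps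
    by (simp add: distrib_left linear_space_closed[OF E])
qed (simp add: zero_in_tensor_product)

lemma tensor_form_scale:
  assumes "u \<in> tensor_product sc N E" "B \<in> bilinear_forms sc E"
  shows "u (\<lambda>\<xi> x. c * B \<xi> x) = c * u B"
  using assms(1)
  by (induction rule: tensor_product_induct)
    (simp_all add: elementary_tensor_def assms bilinear_forms_scale algebra_simps)

lemma tensor_map_in_tensor_product:
  assumes a: "Vector_Spaces.linear sc sc a" "a ` N \<subseteq> M" and \<phi>: "linear_map G E \<phi>"
    and u: "u \<in> tensor_product sc N G"
  shows "tensor_map sc E a \<phi> u \<in> tensor_product sc M E"
  using u
proof (induction rule: tensor_product_induct)
  case zero
  then show ?case by (simp add: tensor_map_def zero_in_tensor_product)
next
  case (add v \<xi> x)
  have "tensor_map sc E a \<phi> (\<lambda>B. v B + elementary_tensor sc G \<xi> x B)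
      = (\<lambda>B. tensor_map sc E a \<phi> v B + tensor_map sc E a \<phi> (elementary_tensor sc G \<xi> x) B)"
    by (auto simp: tensor_map_def)
  also have "tensor_map sc E a \<phi> (elementary_tensor sc G \<xi> x) = elementary_tensor sc E (a \<xi>) (\<phi> x)"
    by (rule tensor_map_elementary[OF a(1)]) (use \<phi> in \<open>auto simp: linear_map_def\<close>)
  finally show ?case
    using tensor_product_add_elementary[OF add.IH, of "a \<xi>" "\<phi> x"] add.hyps a(2) \<phi>
    by (auto simp: linear_map_def)
qed

lemma tensor_map_cong:
  assumes "u \<in> tensor_product sc N G"
    and "Vector_Spaces.linear sc sc a" "Vector_Spaces.linear sc sc b"
    and "linear_map G E \<phi>" "linear_map G E \<psi>"
    and "\<And>\<xi>. \<xi> \<in> N \<Longrightarrow> a \<xi> = b \<xi>" "\<And>x. x \<in> carrier G \<Longrightarrow> \<phi> x = \<psi> x"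
  shows "tensor_map sc E a \<phi> u = tensor_map sc E b \<psi> u"
proof
  fix B
  have "u (\<lambda>\<xi> x. B (a \<xi>) (\<phi> x)) = u (\<lambda>\<xi> x. B (b \<xi>) (\<psi> x))" if "B \<in> bilinear_forms sc E"
    by (rule tensor_form_cong[OF assms(1)]) (use assms that in \<open>auto intro: bilinear_forms_compose\<close>)
  then show "tensor_map sc E a \<phi> u B = tensor_map sc E b \<psi> u B"
    by (simp add: tensor_map_def)
qed

lemma linear_id: "Vector_Spaces.linear sc sc id"
  by (simp add: linear_operator_iff)

lemma tensor_map_id: "u \<in> tensor_product sc N E \<Longrightarrow> tensor_map sc E id id u = u"
  using tensor_form_off by (fastforce simp: tensor_map_def)

subsection \<open>Slice maps\<close>

text \<open>The map \<open>f \<otimes> 1\<close> from \<open>L \<otimes> E\<close> to \<open>E\<close>.\<close>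

definition slice ::
  "('k, 'e, 'z) module_scheme \<Rightarrow> ('k, 'l, 'e) tensor \<Rightarrow> ('l \<Rightarrow> 'k) \<Rightarrow> 'e"
  where "slice E u f =
    (THE y. y \<in> carrier E \<and> (\<forall>k. linear_form E k \<longrightarrow> k y = u (\<lambda>\<xi> x. f \<xi> * k x)))"

lemma slice_eqI:
  assumes "linear_space E" "y \<in> carrier E"
    and "\<And>k. linear_form E k \<Longrightarrow> k y = u (\<lambda>\<xi> x. f \<xi> * k x)"
  shows "slice E u f = y"
  unfolding slice_def
  by (rule the_equality) (use assms in \<open>auto intro: linear_form_eqI\<close>)

lemma slice_zero:
  assumes E: "linear_space E"
  shows "slice E (\<lambda>_. 0) f = \<zero>\<^bsub>E\<^esub>"
  by (rule slice_eqI[OF E]) (simp_all add: linear_space_closed[OF E] linear_form_zero[OF E])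

text \<open>Existence by induction, an elementary tensor of \<xi> and \<open>x\<close> contributing
  \<open>f \<xi>\<close> times \<open>x\<close>; uniqueness because linear forms separate points.
  Independence of the chosen representation of the tensor is thereby automatic.\<close>

lemma slice:
  assumes E: "linear_space E" and f: "Vector_Spaces.linear sc (*) f"
    and u: "u \<in> tensor_product sc N E"
  shows slice_closed: "slice E u f \<in> carrier E"
    and linear_form_slice: "linear_form E k \<Longrightarrow> k (slice E u f) = u (\<lambda>\<xi> x. f \<xi> * k x)"
proof -
  have "\<exists>y. y \<in> carrier E \<and> (\<forall>k. linear_form E k \<longrightarrow> k y = u (\<lambda>\<xi> x. f \<xi> * k x))"
    using u
  proof (induction rule: tensor_product_induct)
    case zero
    show ?case using linear_space_closed(1)[OF E] linear_form_zero[OF E] by blast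
  next
    case (add v \<xi> x)
    then obtain y where y: "y \<in> carrier E"
      "\<And>k. linear_form E k \<Longrightarrow> k y = v (\<lambda>\<xi> x. f \<xi> * k x)" by blast
    show ?case
    proof (intro exI[of _ "y \<oplus>\<^bsub>E\<^esub> f \<xi> \<odot>\<^bsub>E\<^esub> x"] conjI allI impI)
      show "y \<oplus>\<^bsub>E\<^esub> f \<xi> \<odot>\<^bsub>E\<^esub> x \<in> carrier E"
        using y add.hyps by (simp add: linear_space_closed[OF E])
      fix k assume k: "linear_form E k"
      have "f \<xi> \<odot>\<^bsub>E\<^esub> x \<in> carrier E" using add.hyps by (simp add: linear_space_closed[OF E])
      then show "k (y \<oplus>\<^bsub>E\<^esub> f \<xi> \<odot>\<^bsub>E\<^esub> x)
          = v (\<lambda>\<xi> x. f \<xi> * k x) + elementary_tensor sc E \<xi> x (\<lambda>\<xi> x. f \<xi> * k x)"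
        using y(2)[OF k] k add.hyps y(1) bilinear_forms_product[OF f k]
        by (simp add: elementary_tensor_def linear_form_def)
    qed
  qed
  then obtain y where y: "y \<in> carrier E" "\<And>k. linear_form E k \<Longrightarrow> k y = u (\<lambda>\<xi> x. f \<xi> * k x)"
    by blast
  then have "slice E u f = y" by (rule slice_eqI[OF E])
  with y show "slice E u f \<in> carrier E"
    "linear_form E k \<Longrightarrow> k (slice E u f) = u (\<lambda>\<xi> x. f \<xi> * k x)" by auto
qed

lemma slice_add_elementary:
  assumes E: "linear_space E" and f: "Vector_Spaces.linear sc (*) f"
    and u: "u \<in> tensor_product sc N E" and x: "x \<in> carrier E"
  shows "slice E (\<lambda>B. u B + elementary_tensor sc E \<xi> x B) f = slice E u f \<oplus>\<^bsub>E\<^esub> f \<xi> \<odot>\<^bsub>E\<^esub> x"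
proof (rule slice_eqI[OF E])
  have *: "slice E u f \<in> carrier E" "f \<xi> \<odot>\<^bsub>E\<^esub> x \<in> carrier E"
    using slice_closed[OF E f u] linear_space_closed[OF E] x by auto
  then show "slice E u f \<oplus>\<^bsub>E\<^esub> f \<xi> \<odot>\<^bsub>E\<^esub> x \<in> carrier E"
    by (simp add: linear_space_closed[OF E])
  fix k assume k: "linear_form E k"
  then show "k (slice E u f \<oplus>\<^bsub>E\<^esub> f \<xi> \<odot>\<^bsub>E\<^esub> x)
      = u (\<lambda>\<xi> x. f \<xi> * k x) + elementary_tensor sc E \<xi> x (\<lambda>\<xi> x. f \<xi> * k x)"
    using * x linear_form_slice[OF E f u k] bilinear_forms_product[OF f k]
    by (simp add: elementary_tensor_def linear_form_def)
qed

text \<open>Testing with \<open>k\<close> after \<phi> is testing with the form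
  \<open>k \<circ> \<phi>\<close> on \<open>G\<close>. Both the naturality of the bijections and one
  half of their invertibility come from this.\<close>

lemma slice_tensor_map:
  assumes G: "linear_space G" and E: "linear_space E" and f: "Vector_Spaces.linear sc (*) f"
    and u: "u \<in> tensor_product sc N G" and \<phi>: "linear_map G E \<phi>"
  shows "slice E (tensor_map sc E id \<phi> u) f = \<phi> (slice G u f)"
proof (rule slice_eqI[OF E])
  show "\<phi> (slice G u f) \<in> carrier E"
    using slice_closed[OF G f u] \<phi> by (auto simp: linear_map_def)
  fix k assume k: "linear_form E k"
  show "k (\<phi> (slice G u f)) = tensor_map sc E id \<phi> u (\<lambda>\<xi> x. f \<xi> * k x)"
    using linear_form_slice[OF G f u linear_form_compose[OF \<phi> k]] bilinear_forms_product[OF f k]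
    by (simp add: tensor_map_def)
qed

lemma slice_add_functional:
  assumes E: "linear_space E" and f: "Vector_Spaces.linear sc (*) f" and g: "Vector_Spaces.linear sc (*) g"
    and u: "u \<in> tensor_product sc N E"
  shows "slice E u (\<lambda>\<xi>. f \<xi> + g \<xi>) = slice E u f \<oplus>\<^bsub>E\<^esub> slice E u g"
proof (rule slice_eqI[OF E])
  show "slice E u f \<oplus>\<^bsub>E\<^esub> slice E u g \<in> carrier E"
    using slice_closed[OF E _ u] f g by (simp add: linear_space_closed[OF E])
  fix k assume k: "linear_form E k"
  then have "k (slice E u f \<oplus>\<^bsub>E\<^esub> slice E u g) = k (slice E u f) + k (slice E u g)"
    using slice_closed[OF E _ u] f g by (simp add: linear_form_def)
  then show "k (slice E u f \<oplus>\<^bsub>E\<^esub> slice E u g) = u (\<lambda>\<xi> x. (f \<xi> + g \<xi>) * k x)"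
    using linear_form_slice[OF E _ u k] f g
      tensor_form_add[OF u bilinear_forms_product[OF f k] bilinear_forms_product[OF g k]]
    by (simp add: distrib_right)
qed

lemma slice_scale_functional:
  assumes E: "linear_space E" and f: "Vector_Spaces.linear sc (*) f"
    and u: "u \<in> tensor_product sc N E"
  shows "slice E u (\<lambda>\<xi>. c * f \<xi>) = c \<odot>\<^bsub>E\<^esub> slice E u f"
proof (rule slice_eqI[OF E])
  show "c \<odot>\<^bsub>E\<^esub> slice E u f \<in> carrier E"
    using slice_closed[OF E f u] by (simp add: linear_space_closed[OF E])
  fix k assume k: "linear_form E k"
  then have "k (c \<odot>\<^bsub>E\<^esub> slice E u f) = c * k (slice E u f)"
    using slice_closed[OF E f u] by (simp add: linear_form_def)
  then show "k (c \<odot>\<^bsub>E\<^esub> slice E u f) = u (\<lambda>\<xi> x. c * f \<xi> * k x)"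
    using linear_form_slice[OF E f u k] tensor_form_scale[OF u bilinear_forms_product[OF f k]]
    by (simp add: mult.assoc)
qed

end

subsection \<open>The injective norm\<close>

context normed_space
begin

lemma norm_le_of_onorm_le_one:
  assumes "bounded_linear f" "onorm f \<le> 1"
  shows "norm (f x) \<le> norm x"
  using onorm[OF assms(1), of x] mult_right_mono[OF assms(2), of "norm x"] by simp

lemma tensor_form_zero: "u \<in> tensor_product sc N E \<Longrightarrow> u (\<lambda>_ _. 0) = 0"
  by (induction rule: tensor_product_induct) (simp_all add: elementary_tensor_def)

text \<open>The supremum has to be shown finite first: over all admissible pairs, an elementary
  tensor of \<xi> and \<open>x\<close> contributes at most
  \<open>norm \<xi> * nrm x\<close>.\<close>

lemma injective_norm_upper:
  assumes w: "w \<in> tensor_product sc N E"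
    and f: "bounded_operator sc (*) f" "\<And>\<xi>. norm (f \<xi>) \<le> norm \<xi>"
    and k: "linear_form E k" "\<And>x. x \<in> carrier E \<Longrightarrow> norm (k x) \<le> nrm x"
  shows "norm (w (\<lambda>\<xi> x. f \<xi> * k x)) \<le> injective_norm sc E nrm w"
proof -
  define A where "A = {f. bounded_operator sc (*) f \<and> onorm f \<le> 1} \<times>
    {g. linear_form E g \<and> (\<forall>x\<in>carrier E. norm (g x) \<le> nrm x)}"
  have "\<exists>K. \<forall>p\<in>A. norm (w (\<lambda>\<xi> x. fst p \<xi> * snd p x)) \<le> K"
    using w
  proof (induction rule: tensor_product_induct)
    case zero
    show ?case by (intro exI[of _ 0]) simp
  next
    case (add v \<xi> x)
    then obtain K where K: "\<forall>p\<in>A. norm (v (\<lambda>\<xi> x. fst p \<xi> * snd p x)) \<le> K" by blast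
    show ?case
    proof (intro exI[of _ "K + norm \<xi> * nrm x"] ballI)
      fix p assume p: "p \<in> A"
      have le: "norm (fst p \<xi>) \<le> norm \<xi>" "norm (snd p x) \<le> nrm x"
        using p add.hyps norm_le_of_onorm_le_one[of "fst p"]
        by (auto simp: A_def bounded_operator_def)
      have "norm (elementary_tensor sc E \<xi> x (\<lambda>\<xi> x. fst p \<xi> * snd p x)) \<le> norm \<xi> * nrm x"
        using le mult_mono[OF le] order.trans[OF norm_ge_zero le(2)]
        by (simp add: elementary_tensor_def norm_mult)
      then show "norm (v (\<lambda>\<xi> x. fst p \<xi> * snd p x)
          + elementary_tensor sc E \<xi> x (\<lambda>\<xi> x. fst p \<xi> * snd p x)) \<le> K + norm \<xi> * nrm x"
        using K p by (intro norm_triangle_le add_mono) auto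
    qed
  qed
  then have bdd: "bdd_above ((\<lambda>(f, g). norm (w (\<lambda>\<xi> x. f \<xi> * g x))) ` A)"
    by (auto simp: bdd_above_def split_beta)
  have "onorm f \<le> 1" using f(2) by (intro onorm_bound) auto
  then have "(f, k) \<in> A" using f(1) k by (simp add: A_def)
  from cSUP_upper[OF this bdd] show ?thesis
    by (simp add: injective_norm_def A_def)
qed

text \<open>Nonnegativity of \<open>nrm\<close> makes the pair of zero functionals admissible, so
  the supremum is over a nonempty set.\<close>

lemma injective_norm_least:
  assumes nrm: "\<And>x. x \<in> carrier E \<Longrightarrow> 0 \<le> nrm x"
    and le: "\<And>f k. bounded_operator sc (*) f \<Longrightarrow> (\<And>\<xi>. norm (f \<xi>) \<le> norm \<xi>) \<Longrightarrow>
      linear_form E k \<Longrightarrow> (\<And>x. x \<in> carrier E \<Longrightarrow> norm (k x) \<le> nrm x) \<Longrightarrow>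
      norm (w (\<lambda>\<xi> x. f \<xi> * k x)) \<le> K"
  shows "injective_norm sc E nrm w \<le> K"
  unfolding injective_norm_def
proof (rule cSUP_least)
  have "bounded_operator sc (*) (\<lambda>_. 0)"
    by (simp add: bounded_operator_def linear_functional_iff)
  moreover have "linear_form E (\<lambda>_. 0)" by (simp add: linear_form_def)
  ultimately have "((\<lambda>_. 0), (\<lambda>_. 0)) \<in> {f. bounded_operator sc (*) f \<and> onorm f \<le> 1} \<times>
      {g. linear_form E g \<and> (\<forall>x\<in>carrier E. norm (g x) \<le> nrm x)}"
    using nrm by (simp add: onorm_zero)
  then show "{f. bounded_operator sc (*) f \<and> onorm f \<le> 1} \<times>
      {g. linear_form E g \<and> (\<forall>x\<in>carrier E. norm (g x) \<le> nrm x)} \<noteq> {}" by blast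
next
  fix p
  assume p: "p \<in> {f. bounded_operator sc (*) f \<and> onorm f \<le> 1} \<times>
      {g. linear_form E g \<and> (\<forall>x\<in>carrier E. norm (g x) \<le> nrm x)}"
  have "norm (w (\<lambda>\<xi> x. fst p \<xi> * snd p x)) \<le> K"
    by (rule le) (use p norm_le_of_onorm_le_one[of "fst p"] in \<open>auto simp: bounded_operator_def\<close>)
  then show "(case p of (f, g) \<Rightarrow> norm (w (\<lambda>\<xi> x. f \<xi> * g x))) \<le> K"
    by (simp add: split_beta)
qed

lemma injective_norm_nonneg:
  assumes "w \<in> tensor_product sc N E" "\<And>x. x \<in> carrier E \<Longrightarrow> 0 \<le> nrm x"
  shows "0 \<le> injective_norm sc E nrm w"
proof -
  have "norm (w (\<lambda>\<xi> x. 0 * 0)) \<le> injective_norm sc E nrm w"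
    by (rule injective_norm_upper[OF assms(1)])
      (simp_all add: bounded_operator_def linear_functional_iff linear_form_def assms(2))
  then show ?thesis by (rule order.trans[OF norm_ge_zero])
qed

text \<open>Rescaling \<open>f\<close> by \<open>1 / K\<close>, with \<open>K = 0\<close> apart. It
  is meant for a contractive functional composed with a bounded operator \<open>a\<close>, where
  \<open>K\<close> is \<open>onorm a\<close>.\<close>

lemma injective_norm_upper_scaled:
  assumes w: "w \<in> tensor_product sc N E"
    and f: "bounded_operator sc (*) f" "\<And>\<xi>. norm (f \<xi>) \<le> K * norm \<xi>" and "0 \<le> K"
    and k: "linear_form E k" "\<And>x. x \<in> carrier E \<Longrightarrow> norm (k x) \<le> nrm x"
  shows "norm (w (\<lambda>\<xi> x. f \<xi> * k x)) \<le> K * injective_norm sc E nrm w"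
proof (cases "K = 0")
  case True
  then have "f \<xi> = 0" for \<xi> using f(2)[of \<xi>] by simp
  then show ?thesis using True tensor_form_zero[OF w] by simp
next
  case False
  then have K: "0 < K" using \<open>0 \<le> K\<close> by simp
  define f' where "f' = (\<lambda>\<xi>. of_real (1 / K) * f \<xi>)"
  have f': "bounded_operator sc (*) f'"
    using f(1) bounded_linear_const_mult[of f "of_real (1 / K)"]
    by (simp add: f'_def bounded_operator_def linear_functional_iff add_divide_distrib)
  have "norm (f' \<xi>) \<le> norm \<xi>" for \<xi>
    using f(2)[of \<xi>] K by (simp add: f'_def norm_mult norm_divide field_simps)
  then have "norm (w (\<lambda>\<xi> x. f' \<xi> * k x)) \<le> injective_norm sc E nrm w"
    by (intro injective_norm_upper[OF w f' _ k])
  moreover have "(\<lambda>\<xi> x. f \<xi> * k x) \<in> bilinear_forms sc E"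
    using f(1) k(1) by (simp add: bilinear_forms_product bounded_operator_def)
  then have "w (\<lambda>\<xi> x. of_real (1 / K) * (f \<xi> * k x)) = of_real (1 / K) * w (\<lambda>\<xi> x. f \<xi> * k x)"
    by (rule tensor_form_scale[OF w])
  ultimately have "norm (w (\<lambda>\<xi> x. f \<xi> * k x)) / K \<le> injective_norm sc E nrm w"
    using K by (simp add: f'_def mult.assoc norm_mult norm_divide)
  then show ?thesis using K by (simp add: field_simps)
qed

lemma minimal_lspace_simps [simp]:
  "carrier (minimal_lspace sc E nrm) = carrier E"
  "zero (minimal_lspace sc E nrm) = zero E"
  "add (minimal_lspace sc E nrm) = add E"
  "smult (minimal_lspace sc E nrm) = smult E"
  "lnorm (minimal_lspace sc E nrm) = injective_norm sc E nrm"
  by (simp_all add: minimal_lspace_def module.extend_def lspace.fields_def)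

lemma linear_form_minimal_lspace [simp]:
  "linear_form (minimal_lspace sc E nrm) = linear_form E"
  by (simp add: linear_form_def fun_eq_iff)

lemma tensor_minimal_lspace [simp]:
  "bilinear_forms sc (minimal_lspace sc E nrm) = bilinear_forms sc E"
  "tensor_product sc N (minimal_lspace sc E nrm) = tensor_product sc N E"
  "tensor_map sc (minimal_lspace sc E nrm) = tensor_map sc E"
  by (simp_all add: bilinear_forms_def tensor_product_def elementary_tensor_def tensor_map_def
      fun_eq_iff)

lemma linear_operators_minimal_lspace [simp]:
  "linear_operators (minimal_lspace sc G nrm) E = linear_operators G E"
  by (simp add: linear_operators_def)

lemma linear_space_minimal_lspace: "linear_space E \<Longrightarrow> linear_space (minimal_lspace sc E nrm)"
  by (rule linear_spaceI)
    (simp_all add: linear_space_closed linear_space_smult, simp_all add: linear_space_ac)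

text \<open>The norm axioms hold for each admissible pair of functionals and pass to the supremum;
  for the module axiom, \<open>a\<close> is moved onto the functional \<open>f\<close>. Definiteness
  is a hypothesis because it depends on how many forms are bounded by \<open>nrm\<close>.\<close>

lemma is_lspace_minimal_lspace:
  assumes E: "linear_space E"
    and nrm: "\<And>x. x \<in> carrier E \<Longrightarrow> 0 \<le> nrm x"
    and definite: "\<And>w. w \<in> tensor_product sc UNIV E \<Longrightarrow> injective_norm sc E nrm w = 0 \<Longrightarrow> w = (\<lambda>_. 0)"
  shows "is_lspace sc (minimal_lspace sc E nrm)"
  unfolding is_lspace_def minimal_lspace_simps tensor_minimal_lspace
proof (intro conjI ballI allI impI iffI)
  show "linear_space (minimal_lspace sc E nrm)" by (rule linear_space_minimal_lspace[OF E])
next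
  fix w assume w: "w \<in> tensor_product sc UNIV E"
  show nonneg: "0 \<le> injective_norm sc E nrm w" by (rule injective_norm_nonneg[OF w nrm])
  show "injective_norm sc E nrm w = 0 \<Longrightarrow> w = (\<lambda>_. 0)" by (rule definite[OF w])
  show "injective_norm sc E nrm w = 0" if "w = (\<lambda>_. 0)"
  proof -
    have "injective_norm sc E nrm w \<le> 0"
      unfolding that by (rule injective_norm_least) (simp_all add: nrm)
    with nonneg show ?thesis by simp
  qed
  fix c
  show "injective_norm sc E nrm (\<lambda>B. c * w B) = norm c * injective_norm sc E nrm w"
  proof (cases "c = 0")
    case True
    have "injective_norm sc E nrm (\<lambda>_. 0) \<le> 0"
      by (rule injective_norm_least) (simp_all add: nrm)
    moreover have "0 \<le> injective_norm sc E nrm (\<lambda>_. 0)"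
      by (rule injective_norm_nonneg[OF zero_in_tensor_product nrm])
    ultimately show ?thesis using True by simp
  next
    case False
    let ?I = "injective_norm sc E nrm (\<lambda>B. c * w B)"
    have "?I \<le> norm c * injective_norm sc E nrm w"
      by (rule injective_norm_least[OF nrm])
        (simp_all add: norm_mult mult_left_mono injective_norm_upper[OF w])
    moreover have "injective_norm sc E nrm w \<le> ?I / norm c"
    proof (rule injective_norm_least[OF nrm])
      fix f k
      assume f: "bounded_operator sc (*) f" "\<And>\<xi>. norm (f \<xi>) \<le> norm \<xi>"
        and k: "linear_form E k" "\<And>x. x \<in> carrier E \<Longrightarrow> norm (k x) \<le> nrm x"
      have "norm (c * w (\<lambda>\<xi> x. f \<xi> * k x)) \<le> ?I"
        by (rule injective_norm_upper[OF tensor_product_scale[OF E w] f k])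
      then show "norm (w (\<lambda>\<xi> x. f \<xi> * k x)) \<le> ?I / norm c"
        using False by (simp add: norm_mult field_simps)
    qed
    ultimately show ?thesis using False by (simp add: field_simps)
  qed
next
  fix w v assume w: "w \<in> tensor_product sc UNIV E" and v: "v \<in> tensor_product sc UNIV E"
  show "injective_norm sc E nrm (\<lambda>B. w B + v B) \<le> injective_norm sc E nrm w + injective_norm sc E nrm v"
    by (rule injective_norm_least[OF nrm])
      (auto intro!: norm_triangle_le add_mono injective_norm_upper[OF w] injective_norm_upper[OF v])
next
  fix a w assume a: "bounded_operator sc sc a" and w: "w \<in> tensor_product sc UNIV E"
  have bl: "bounded_linear a" and lin: "Vector_Spaces.linear sc sc a"
    using a by (simp_all add: bounded_operator_def)
  show "injective_norm sc E nrm (tensor_map sc E a id w) \<le> onorm a * injective_norm sc E nrm w"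
  proof (rule injective_norm_least[OF nrm])
    fix f k
    assume f: "bounded_operator sc (*) f" "\<And>\<xi>. norm (f \<xi>) \<le> norm \<xi>"
      and k: "linear_form E k" "\<And>x. x \<in> carrier E \<Longrightarrow> norm (k x) \<le> nrm x"
    have fa: "bounded_operator sc (*) (\<lambda>\<xi>. f (a \<xi>))"
      using f(1) lin bounded_linear_compose[OF _ bl, of f]
      by (simp add: bounded_operator_def linear_functional_iff linear_operator_iff)
    have "norm (w (\<lambda>\<xi> x. f (a \<xi>) * k x)) \<le> onorm a * injective_norm sc E nrm w"
      by (rule injective_norm_upper_scaled[OF w fa _ _ k])
        (auto intro: order.trans[OF f(2) onorm[OF bl]] simp: onorm_pos_le[OF bl])
    then show "norm (tensor_map sc E a id w (\<lambda>\<xi> x. f \<xi> * k x)) \<le> onorm a * injective_norm sc E nrm w"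
      using bilinear_forms_product[of f E k] f(1) k(1)
      by (simp add: tensor_map_def bounded_operator_def)
  qed
qed

end

subsection \<open>The dual of a complemented subspace\<close>

lemma carrier_dual_space: "f \<in> carrier (dual_space sc N) \<longleftrightarrow>
    (\<forall>\<xi>\<in>N. \<forall>\<eta>\<in>N. f (\<xi> + \<eta>) = f \<xi> + f \<eta>) \<and> (\<forall>c. \<forall>\<xi>\<in>N. f (sc c \<xi>) = c * f \<xi>) \<and>
    (\<exists>K. \<forall>\<xi>\<in>N. norm (f \<xi>) \<le> K * norm \<xi>) \<and> (\<forall>\<xi>. \<xi> \<notin> N \<longrightarrow> f \<xi> = 0)"
  by (simp add: dual_space_def)

lemma dual_space_simps [simp]:
  "zero (dual_space sc N) = (\<lambda>_. 0)"
  "f \<oplus>\<^bsub>dual_space sc N\<^esub> g = (\<lambda>\<xi>. f \<xi> + g \<xi>)"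
  "c \<odot>\<^bsub>dual_space sc N\<^esub> f = (\<lambda>\<xi>. c * f \<xi>)"
  by (simp_all add: dual_space_def)

lemma linear_space_dual_space: "linear_space (dual_space sc N)"
proof (rule linear_spaceI)
  fix f g assume f: "f \<in> carrier (dual_space sc N)" and g: "g \<in> carrier (dual_space sc N)"
  obtain K M where K: "\<forall>\<xi>\<in>N. norm (f \<xi>) \<le> K * norm \<xi>" and M: "\<forall>\<xi>\<in>N. norm (g \<xi>) \<le> M * norm \<xi>"
    using f g by (auto simp: carrier_dual_space)
  have "norm (f \<xi> + g \<xi>) \<le> (K + M) * norm \<xi>" if "\<xi> \<in> N" for \<xi>
    using K M that norm_triangle_ineq[of "f \<xi>" "g \<xi>"] by (fastforce simp: distrib_right)
  then have "\<exists>K. \<forall>\<xi>\<in>N. norm (f \<xi> + g \<xi>) \<le> K * norm \<xi>" by blast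
  then show "f \<oplus>\<^bsub>dual_space sc N\<^esub> g \<in> carrier (dual_space sc N)"
    using f g by (simp add: carrier_dual_space algebra_simps)
next
  fix c f assume f: "f \<in> carrier (dual_space sc N)"
  obtain K where K: "\<forall>\<xi>\<in>N. norm (f \<xi>) \<le> K * norm \<xi>"
    using f by (auto simp: carrier_dual_space)
  have "norm (c * f \<xi>) \<le> (norm c * K) * norm \<xi>" if "\<xi> \<in> N" for \<xi>
    using K that by (simp add: norm_mult mult.assoc mult_left_mono)
  then have "\<exists>K. \<forall>\<xi>\<in>N. norm (c * f \<xi>) \<le> K * norm \<xi>" by blast
  then show "c \<odot>\<^bsub>dual_space sc N\<^esub> f \<in> carrier (dual_space sc N)"
    using f by (simp add: carrier_dual_space algebra_simps)
qed (auto simp: carrier_dual_space algebra_simps intro: exI[of _ 0])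

lemma linear_form_eval: "linear_form (dual_space sc N) (\<lambda>g. g \<xi>)"
  by (simp add: linear_form_def)

text \<open>Membership of the partial sums in the carrier is proved in the same induction, since
  \<open>k\<close> is additive only there.\<close>

lemma linear_form_dual_space_sum:
  fixes n :: nat
  assumes k: "linear_form (dual_space sc N) k"
    and h: "\<And>i. i < n \<Longrightarrow> h i \<in> carrier (dual_space sc N)"
  shows "k (\<lambda>\<xi>. \<Sum>i<n. c i * h i \<xi>) = (\<Sum>i<n. c i * k (h i))"
proof -
  let ?D = "dual_space sc N"
  note D = linear_space_closed[OF linear_space_dual_space[of sc N]]
  have "(\<lambda>\<xi>. \<Sum>i<n. c i * h i \<xi>) \<in> carrier ?D \<and>
      k (\<lambda>\<xi>. \<Sum>i<n. c i * h i \<xi>) = (\<Sum>i<n. c i * k (h i))"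
    using h
  proof (induction n)
    case 0
    show ?case
      using D(1) linear_form_zero[OF linear_space_dual_space k] by simp
  next
    case (Suc n)
    define s where "s = (\<lambda>\<xi>. \<Sum>i<n. c i * h i \<xi>)"
    have s: "s \<in> carrier ?D" "k s = (\<Sum>i<n. c i * k (h i))"
      using Suc by (simp_all add: s_def)
    have hn: "h n \<in> carrier ?D" using Suc.prems by simp
    have eq: "(\<lambda>\<xi>. \<Sum>i<Suc n. c i * h i \<xi>) = s \<oplus>\<^bsub>?D\<^esub> c n \<odot>\<^bsub>?D\<^esub> h n"
      by (simp add: s_def)
    have "k (s \<oplus>\<^bsub>?D\<^esub> c n \<odot>\<^bsub>?D\<^esub> h n) = k s + c n * k (h n)"
      using k s(1) hn D(3)[OF hn] unfolding linear_form_def by metis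
    then show ?case
      unfolding eq using s D(2)[OF s(1) D(3)[OF hn]] by simp
  qed
  then show ?thesis by blast
qed

section \<open>Functionals and tensors along a contractive projection\<close>

locale complemented_subspace = normed_space sc
  for sc :: "'k::real_or_complex \<Rightarrow> 'l::real_normed_vector \<Rightarrow> 'l" +
  fixes P :: "'l \<Rightarrow> 'l" and N :: "'l set"
  assumes P: "bounded_operator sc sc P" and idem: "P \<circ> P = P" and P_le: "onorm P \<le> 1"
    and range: "range P = N"
begin

abbreviation D :: "('k, 'l \<Rightarrow> 'k) module" where "D \<equiv> dual_space sc N"

lemma bounded_linear_P: "bounded_linear P" and linear_P: "Vector_Spaces.linear sc sc P"
  using P by (simp_all add: bounded_operator_def)

lemma P_add: "P (x + y) = P x + P y" and P_sc: "P (sc c x) = sc c (P x)"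
  using linear_P by (simp_all add: linear_operator_iff)

lemma P_in: "P \<xi> \<in> N" and P_id: "\<xi> \<in> N \<Longrightarrow> P \<xi> = \<xi>"
  using idem range by (auto simp: fun_eq_iff)

lemma norm_P_le: "norm (P \<xi>) \<le> norm \<xi>"
  by (rule norm_le_of_onorm_le_one[OF bounded_linear_P P_le])

lemma N_closed: "0 \<in> N" "\<xi> \<in> N \<Longrightarrow> \<eta> \<in> N \<Longrightarrow> \<xi> + \<eta> \<in> N" "\<xi> \<in> N \<Longrightarrow> sc c \<xi> \<in> N"
proof -
  have "P 0 = 0" using P_sc[of 0 0] by simp
  then show "0 \<in> N" using P_in[of 0] by simp
  show "\<xi> \<in> N \<Longrightarrow> \<eta> \<in> N \<Longrightarrow> \<xi> + \<eta> \<in> N"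
    using P_in[of "\<xi> + \<eta>"] by (simp add: P_add P_id)
  show "\<xi> \<in> N \<Longrightarrow> sc c \<xi> \<in> N"
    using P_in[of "sc c \<xi>"] by (simp add: P_sc P_id)
qed

text \<open>Composition with \<open>P\<close> extends functionals from \<open>N\<close> to
  \<open>L\<close> linearly in \<open>g\<close>, which a separate Hahn-Banach choice for each
  \<open>g\<close> would not guarantee.\<close>

lemma dual_extension:
  assumes "g \<in> carrier D"
  shows "bounded_operator sc (*) (\<lambda>\<xi>. g (P \<xi>))"
proof -
  obtain K where K: "\<forall>\<xi>\<in>N. norm (g \<xi>) \<le> K * norm \<xi>"
    using assms by (auto simp: carrier_dual_space)
  \<comment> \<open>The constant \<open>K\<close> may be negative when \<open>N\<close> is zero,
    hence the absolute value.\<close>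
  have "norm (g (P \<xi>)) \<le> \<bar>K\<bar> * norm \<xi>" for \<xi>
  proof -
    have "norm (g (P \<xi>)) \<le> K * norm (P \<xi>)" using K P_in by blast
    also have "\<dots> \<le> \<bar>K\<bar> * norm \<xi>" using norm_P_le by (intro mult_mono) auto
    finally show ?thesis .
  qed
  moreover have "Vector_Spaces.linear sc (*) (\<lambda>\<xi>. g (P \<xi>))"
    using assms by (simp add: linear_functional_iff carrier_dual_space P_add P_sc P_in)
  ultimately show ?thesis by (intro bounded_operatorI[OF normed_space_mult])
qed

lemma linear_dual_extension:
  "g \<in> carrier D \<Longrightarrow> Vector_Spaces.linear sc (*) (\<lambda>\<xi>. g (P \<xi>))"
  using dual_extension by (simp add: bounded_operator_def)

definition functional_restrict :: "('l \<Rightarrow> 'k) \<Rightarrow> 'l \<Rightarrow> 'k"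
  where "functional_restrict f = (\<lambda>\<xi>. if \<xi> \<in> N then f \<xi> else 0)"

lemma functional_restrict_in_dual:
  assumes "bounded_operator sc (*) f"
  shows "functional_restrict f \<in> carrier D"
proof -
  have "\<forall>\<xi>\<in>N. norm (f \<xi>) \<le> onorm f * norm \<xi>"
    using assms by (auto simp: bounded_operator_def intro: onorm)
  then have "\<exists>K. \<forall>\<xi>\<in>N. norm (f \<xi>) \<le> K * norm \<xi>" by blast
  then show ?thesis
    using assms unfolding bounded_operator_def linear_functional_iff
    by (simp add: carrier_dual_space functional_restrict_def N_closed)
qed

lemma functional_restrict_extension: "g \<in> carrier D \<Longrightarrow> functional_restrict (\<lambda>\<xi>. g (P \<xi>)) = g"
  by (auto simp: functional_restrict_def carrier_dual_space P_id)

lemma norm_le_dual_norm: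
  assumes g: "g \<in> carrier D" and \<xi>: "\<xi> \<in> N" "norm \<xi> \<le> 1"
  shows "norm (g \<xi>) \<le> dual_norm N g"
  unfolding dual_norm_def
proof (rule cSUP_upper)
  obtain K where K: "\<forall>\<xi>\<in>N. norm (g \<xi>) \<le> K * norm \<xi>"
    using g by (auto simp: carrier_dual_space)
  show "bdd_above ((\<lambda>\<xi>. norm (g \<xi>)) ` {\<xi> \<in> N. norm \<xi> \<le> 1})"
  proof (rule bdd_aboveI2)
    fix \<eta> assume "\<eta> \<in> {\<xi> \<in> N. norm \<xi> \<le> 1}"
    then have \<eta>: "\<eta> \<in> N" "norm \<eta> \<le> 1" by auto
    then have "norm (g \<eta>) \<le> K * norm \<eta>" using K by blast
    also have "\<dots> \<le> \<bar>K\<bar> * 1" using \<eta> by (intro mult_mono) auto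
    finally show "norm (g \<eta>) \<le> \<bar>K\<bar>" by simp
  qed
qed (use \<xi> in simp)

lemma dual_norm_nonneg: "g \<in> carrier D \<Longrightarrow> 0 \<le> dual_norm N g"
  using norm_le_dual_norm[of g 0] N_closed(1) by (simp add: order.trans[OF norm_ge_zero])

lemma dual_norm_restrict_le:
  assumes "\<And>\<xi>. norm (f \<xi>) \<le> norm \<xi>"
  shows "dual_norm N (functional_restrict f) \<le> 1"
  unfolding dual_norm_def
proof (rule cSUP_least)
  show "{\<xi> \<in> N. norm \<xi> \<le> 1} \<noteq> {}" using N_closed(1) by force
qed (auto simp: functional_restrict_def intro: order.trans[OF assms])

lemma linear_map_slice:
  assumes "linear_space E" "u \<in> tensor_product sc M E"
  shows "linear_map D E (\<lambda>g. slice E u (\<lambda>\<xi>. g (P \<xi>)))"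
  using assms linear_dual_extension
  by (auto simp: linear_map_def slice_closed slice_add_functional slice_scale_functional)

text \<open>Under \<open>L \<otimes> N\<^sup>* = Hom(N, L)\<close> the tensor \<open>w\<close> is an operator on \<open>N\<close>;
  here it is composed with the projection \<open>P\<close>.\<close>

definition represents :: "('l \<Rightarrow> 'l) \<Rightarrow> ('k, 'l, 'l \<Rightarrow> 'k) tensor \<Rightarrow> bool"
  where "represents T w \<longleftrightarrow> bounded_operator sc sc T \<and>
    (\<forall>f \<xi>. Vector_Spaces.linear sc (*) f \<longrightarrow> f (T \<xi>) = w (\<lambda>\<eta> g. f \<eta> * g (P \<xi>)))"

lemma represents_bounded_operator: "represents T w \<Longrightarrow> bounded_operator sc sc T"
  and represents_form:
    "represents T w \<Longrightarrow> Vector_Spaces.linear sc (*) f \<Longrightarrow> f (T \<xi>) = w (\<lambda>\<eta> g. f \<eta> * g (P \<xi>))"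
  by (auto simp: represents_def)

lemma bounded_operator_rank_one:
  assumes "bounded_operator sc (*) f"
  shows "bounded_operator sc sc (\<lambda>\<xi>. sc (f \<xi>) \<eta>)"
proof (rule bounded_operatorI[OF normed_space_axioms])
  show "Vector_Spaces.linear sc sc (\<lambda>\<xi>. sc (f \<xi>) \<eta>)"
    using assms by (simp add: bounded_operator_def linear_functional_iff linear_operator_iff
        scale_left_distrib)
  show "norm (sc (f \<xi>) \<eta>) \<le> (onorm f * norm \<eta>) * norm \<xi>" for \<xi>
    using mult_right_mono[OF onorm[of f \<xi>], of "norm \<eta>"] assms
    by (simp add: bounded_operator_def norm_sc mult_ac)
qed

text \<open>An elementary tensor of \<eta> and \<open>g\<close> is represented by the rank-one
  operator sending \<xi> to \<open>g (P \<xi>)\<close> times \<eta>, and representing operators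
  add.\<close>

lemma tensor_represented:
  assumes "w \<in> tensor_product sc M D"
  shows "\<exists>T. represents T w"
  using assms
proof (induction rule: tensor_product_induct)
  case zero
  have "f 0 = 0" if "Vector_Spaces.linear sc (*) f" for f
  proof -
    have "f (sc 0 0) = 0 * f 0" using that unfolding linear_functional_iff by blast
    then show ?thesis by simp
  qed
  then show ?case
    by (intro exI[of _ "\<lambda>_. 0"]) (simp add: represents_def bounded_operator_def linear_operator_iff)
next
  case (add v \<eta> g)
  then obtain T where T: "represents T v" by blast
  have "bounded_operator sc sc (\<lambda>\<xi>. T \<xi> + sc (g (P \<xi>)) \<eta>)"
    using represents_bounded_operator[OF T]
      bounded_operator_rank_one[OF dual_extension[OF add.hyps(3)], of \<eta>]
    by (simp add: bounded_operator_def linear_operator_iff bounded_linear_add scale_right_distrib)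
  moreover have "f (T \<xi> + sc (g (P \<xi>)) \<eta>)
      = v (\<lambda>\<eta> g. f \<eta> * g (P \<xi>)) + elementary_tensor sc D \<eta> g (\<lambda>\<eta> g. f \<eta> * g (P \<xi>))"
    if f: "Vector_Spaces.linear sc (*) f" for f \<xi>
  proof -
    have "(\<lambda>\<eta> g. f \<eta> * g (P \<xi>)) \<in> bilinear_forms sc D"
      by (rule bilinear_forms_product[OF f linear_form_eval])
    then have "elementary_tensor sc D \<eta> g (\<lambda>\<eta> g. f \<eta> * g (P \<xi>)) = g (P \<xi>) * f \<eta>"
      by (simp add: elementary_tensor_def)
    then show ?thesis
      using represents_form[OF T f, of \<xi>] f by (simp add: linear_functional_iff)
  qed
  ultimately show ?case unfolding represents_def by blast
qed

text \<open>By additivity it is enough to look at an elementary \<open>u\<close> of \<xi> and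
  \<open>x\<close>. Its operator sends \<open>g\<close> to \<open>g (P \<xi>)\<close> times
  \<open>x\<close>; pairing \<open>w\<close> with \<open>B \<eta> x * g (P \<xi>)\<close> gives
  \<open>B (T \<xi>) x\<close>, by \<open>represents\<close> for the functional \<open>B\<close>
  with \<open>x\<close> fixed. As \<open>B\<close> is an arbitrary bilinear form, this functional
  may be unbounded, which is why \<open>represents\<close> ranges over all linear
  functionals.\<close>

lemma tensor_map_slice:
  assumes E: "linear_space E" and w: "w \<in> tensor_product sc M D" and T: "represents T w"
    and u: "u \<in> tensor_product sc M' E"
  shows "tensor_map sc E id (\<lambda>g. slice E u (\<lambda>\<xi>. g (P \<xi>))) w = tensor_map sc E T id u"
proof
  fix B
  have "w (\<lambda>\<eta> g. B \<eta> (slice E u (\<lambda>\<xi>. g (P \<xi>)))) = u (\<lambda>\<xi> x. B (T \<xi>) x)"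
    if B: "B \<in> bilinear_forms sc E"
    using u
  proof (induction rule: tensor_product_induct)
    case zero
    show ?case
      using tensor_form_zero[OF w] linear_form_zero[OF E linear_form_bilinear[OF B]]
      by (simp add: slice_zero[OF E])
  next
    case (add v \<xi> x)
    have f: "Vector_Spaces.linear sc (*) (\<lambda>\<eta>. B \<eta> x)"
      by (rule linear_functional_bilinear[OF B add.hyps(3)])
    have 1: "(\<lambda>\<eta> g. B \<eta> (slice E v (\<lambda>\<xi>. g (P \<xi>)))) \<in> bilinear_forms sc D"
      using bilinear_forms_compose[OF linear_id linear_map_slice[OF E add.hyps(1)] B] by simp
    have 2: "(\<lambda>\<eta> g. B \<eta> x * g (P \<xi>)) \<in> bilinear_forms sc D"
      by (rule bilinear_forms_product[OF f linear_form_eval])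
    have slice_eq: "B \<eta> (slice E (\<lambda>C. v C + elementary_tensor sc E \<xi> x C) (\<lambda>\<xi>. g (P \<xi>)))
        = B \<eta> (slice E v (\<lambda>\<xi>. g (P \<xi>))) + B \<eta> x * g (P \<xi>)" if g: "g \<in> carrier D" for \<eta> g
      using linear_form_bilinear[OF B, of \<eta>] add.hyps(3)
        slice_closed[OF E linear_dual_extension[OF g] add.hyps(1)] linear_space_closed[OF E]
      by (simp add: slice_add_elementary[OF E linear_dual_extension[OF g] add.hyps(1,3)]
          linear_form_def mult.commute)
    have "w (\<lambda>\<eta> g. B \<eta> (slice E (\<lambda>C. v C + elementary_tensor sc E \<xi> x C) (\<lambda>\<xi>. g (P \<xi>))))
        = w (\<lambda>\<eta> g. B \<eta> (slice E v (\<lambda>\<xi>. g (P \<xi>))) + B \<eta> x * g (P \<xi>))"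
    proof (rule tensor_form_cong[OF w _ bilinear_forms_add[OF 1 2] slice_eq])
      show "(\<lambda>\<eta> g. B \<eta> (slice E (\<lambda>C. v C + elementary_tensor sc E \<xi> x C) (\<lambda>\<xi>. g (P \<xi>))))
          \<in> bilinear_forms sc D"
        using bilinear_forms_compose[OF linear_id
            linear_map_slice[OF E tensor_product_add_elementary[OF add.hyps]] B] by simp
    qed
    also have "\<dots> = v (\<lambda>\<xi> x. B (T \<xi>) x) + B (T \<xi>) x"
      by (simp add: tensor_form_add[OF w 1 2] add.IH represents_form[OF T f])
    also have "B (T \<xi>) x = elementary_tensor sc E \<xi> x (\<lambda>\<xi> x. B (T \<xi>) x)"
      using bilinear_forms_compose[OF _ linear_map_id B, of T] represents_bounded_operator[OF T]
      by (simp add: elementary_tensor_def bounded_operator_def)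
    finally show ?case .
  qed
  then show "tensor_map sc E id (\<lambda>g. slice E u (\<lambda>\<xi>. g (P \<xi>))) w B = tensor_map sc E T id u B"
    by (simp add: tensor_map_def)
qed

text \<open>Pair \<open>w\<close> with a norming functional of \<open>T \<xi>\<close> and the
  evaluation at \<open>P (c \<xi>)\<close>. With \<open>c\<close> the inverse of the norm of \<xi>,
  this point lies in the unit ball of \<open>N\<close>, so the evaluation is bounded by
  \<open>dual_norm N\<close>.\<close>

lemma onorm_le_injective_norm:
  assumes w: "w \<in> tensor_product sc M D" and T: "represents T w"
  shows "onorm T \<le> injective_norm sc D (dual_norm N) w"
proof (rule onorm_bound)
  show "0 \<le> injective_norm sc D (dual_norm N) w"
    by (rule injective_norm_nonneg[OF w dual_norm_nonneg])
  fix \<xi>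
  show "norm (T \<xi>) \<le> injective_norm sc D (dual_norm N) w * norm \<xi>"
  proof (cases "\<xi> = 0")
    case True
    then show ?thesis
      using represents_bounded_operator[OF T]
      by (simp add: bounded_operator_def linear_simps)
  next
    case False
    define c :: 'k where "c = of_real (1 / norm \<xi>)"
    obtain f where f: "bounded_operator sc (*) f" "\<And>x. norm (f x) \<le> norm x"
      "norm (f (T \<xi>)) = norm (T \<xi>)"
      using norming_functional[of "T \<xi>"] by blast
    have f_lin: "Vector_Spaces.linear sc (*) f" using f(1) by (simp add: bounded_operator_def)
    have "norm (P (sc c \<xi>)) \<le> 1"
      using norm_P_le[of "sc c \<xi>"] False by (simp add: norm_sc c_def norm_divide)
    then have "norm (w (\<lambda>\<eta> g. f \<eta> * g (P (sc c \<xi>)))) \<le> injective_norm sc D (dual_norm N) w"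
      using norm_le_dual_norm[OF _ P_in]
      by (intro injective_norm_upper[OF w f(1,2) linear_form_eval]) auto
    also have "w (\<lambda>\<eta> g. f \<eta> * g (P (sc c \<xi>))) = c * f (T \<xi>)"
      using represents_form[OF T f_lin, of "sc c \<xi>", symmetric] f_lin represents_bounded_operator[OF T]
      by (simp add: linear_functional_iff bounded_operator_def linear_operator_iff)
    finally show ?thesis
      using False f(3) by (simp add: norm_mult c_def norm_divide field_simps)
  qed
qed

text \<open>The tensor of the identity of \<open>N\<close> under \<open>N \<otimes> N\<^sup>* = Hom(N, N)\<close>.\<close>

lemma identity_tensor_exists:
  assumes "finite_dimensional sc N"
  shows "\<exists>w\<in>tensor_product sc N D. \<forall>f k. bounded_operator sc (*) f \<longrightarrow> linear_form D k \<longrightarrow>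
    w (\<lambda>\<eta> g. f \<eta> * k g) = k (functional_restrict f)"
proof -
  obtain B where B: "finite B" "span B = N"
    using assms by (auto simp: finite_dimensional_def)
  obtain n :: nat and v g where vg: "\<And>i. i < n \<Longrightarrow> v i \<in> N \<and> bounded_operator sc (*) (g i)"
    and sum: "\<And>\<xi>. \<xi> \<in> N \<Longrightarrow> (\<Sum>i<n. sc (g i \<xi>) (v i)) = \<xi>"
    using span_dual_system[OF B(1)] unfolding B(2) by blast
  define w where "w = (\<lambda>C. \<Sum>i<n. elementary_tensor sc D (v i) (functional_restrict (g i)) C)"
  have g_dual: "functional_restrict (g i) \<in> carrier D" if "i < n" for i
    using vg[OF that] functional_restrict_in_dual by blast
  have "w \<in> tensor_product sc N D"
    unfolding tensor_product_def w_def using vg g_dual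
    by (intro CollectI exI[of _ n] exI[of _ v] exI[of _ "\<lambda>i. functional_restrict (g i)"] conjI refl) auto
  moreover have "w (\<lambda>\<eta> g. f \<eta> * k g) = k (functional_restrict f)"
    if f: "bounded_operator sc (*) f" and k: "linear_form D k" for f k
  proof -
    have lin: "Vector_Spaces.linear sc (*) f" using f by (simp add: bounded_operator_def)
    have f_sum: "f (\<Sum>i<m. sc (a i) (v i)) = (\<Sum>i<m. a i * f (v i))" for m :: nat and a
    proof (induction m)
      case 0
      have "f (sc 0 0) = 0 * f 0" using lin unfolding linear_functional_iff by blast
      then show ?case by simp
    next
      case (Suc m)
      then show ?case using lin by (simp add: linear_functional_iff)
    qed
    \<comment> \<open>This is \<open>f\<close> applied to the resolution of the identity on
      \<open>N\<close>; an arbitrary form \<open>k\<close> can then be evaluated term by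
      term.\<close>
    have "functional_restrict f = (\<lambda>\<xi>. \<Sum>i<n. f (v i) * functional_restrict (g i) \<xi>)"
    proof
      fix \<xi>
      show "functional_restrict f \<xi> = (\<Sum>i<n. f (v i) * functional_restrict (g i) \<xi>)"
      proof (cases "\<xi> \<in> N")
        case True
        then show ?thesis
          using f_sum[of "\<lambda>i. g i \<xi>" n] sum[OF True]
          by (simp add: functional_restrict_def mult.commute)
      qed (simp add: functional_restrict_def)
    qed
    then have "k (functional_restrict f) = (\<Sum>i<n. f (v i) * k (functional_restrict (g i)))"
      by (simp only: linear_form_dual_space_sum[OF k g_dual])
    then show ?thesis
      using bilinear_forms_product[OF lin k] by (simp add: w_def elementary_tensor_def)
  qed
  ultimately show ?thesis by blast
qed

end

section \<open>The identity tensor and the minimal L-space in finite dimension\<close>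

locale findim_complemented_subspace = complemented_subspace sc P N
  for sc :: "'k::real_or_complex \<Rightarrow> 'l::real_normed_vector \<Rightarrow> 'l" and P N +
  assumes findim: "finite_dimensional sc N"
begin

definition identity_tensor :: "('k, 'l, 'l \<Rightarrow> 'k) tensor"
  where "identity_tensor = (SOME w. w \<in> tensor_product sc N D \<and>
    (\<forall>f k. bounded_operator sc (*) f \<longrightarrow> linear_form D k \<longrightarrow>
      w (\<lambda>\<eta> g. f \<eta> * k g) = k (functional_restrict f)))"

lemma identity_tensor:
  shows identity_tensor_in: "identity_tensor \<in> tensor_product sc N D"
    and identity_tensor_form: "bounded_operator sc (*) f \<Longrightarrow> linear_form D k \<Longrightarrow>
      identity_tensor (\<lambda>\<eta> g. f \<eta> * k g) = k (functional_restrict f)"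
proof -
  have "identity_tensor \<in> tensor_product sc N D \<and>
    (\<forall>f k. bounded_operator sc (*) f \<longrightarrow> linear_form D k \<longrightarrow>
      identity_tensor (\<lambda>\<eta> g. f \<eta> * k g) = k (functional_restrict f))"
    unfolding identity_tensor_def
    by (rule someI_ex[OF identity_tensor_exists[OF findim, unfolded Bex_def]])
  then show "identity_tensor \<in> tensor_product sc N D"
    "bounded_operator sc (*) f \<Longrightarrow> linear_form D k \<Longrightarrow>
      identity_tensor (\<lambda>\<eta> g. f \<eta> * k g) = k (functional_restrict f)" by blast+
qed

lemma identity_tensor_in_UNIV: "identity_tensor \<in> tensor_product sc UNIV D"
  using identity_tensor_in tensor_product_mono[of N UNIV] by blast

text \<open>Extending \<open>g\<close> by \<open>P\<close> and restricting again returns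
  \<open>g\<close>, so the operator attached to the identity tensor is the identity of
  \<open>D\<close>.\<close>

lemma slice_identity_tensor:
  assumes "g \<in> carrier D"
  shows "slice D identity_tensor (\<lambda>\<xi>. g (P \<xi>)) = g"
  using assms
  by (intro slice_eqI[OF linear_space_dual_space])
    (simp_all add: identity_tensor_form dual_extension functional_restrict_extension)

text \<open>The pairing with \<open>f\<close> and \<open>k\<close> is \<open>k\<close> at the
  restriction of \<open>f\<close> to \<open>N\<close>, and this restriction has dual norm at most
  one.\<close>

lemma injective_norm_identity_tensor: "injective_norm sc D (dual_norm N) identity_tensor \<le> 1"
proof (rule injective_norm_least[OF dual_norm_nonneg])
  fix f k
  assume f: "bounded_operator sc (*) f" "\<And>\<xi>. norm (f \<xi>) \<le> norm \<xi>"
    and k: "linear_form D k" "\<And>g. g \<in> carrier D \<Longrightarrow> norm (k g) \<le> dual_norm N g"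
  show "norm (identity_tensor (\<lambda>\<xi> g. f \<xi> * k g)) \<le> 1"
    using order.trans[OF k(2)[OF functional_restrict_in_dual[OF f(1)]] dual_norm_restrict_le[OF f(2)]]
    by (simp add: identity_tensor_form[OF f(1) k(1)])
qed

text \<open>The defining property of the identity tensor covers only bounded functionals, whereas
  \<open>represents\<close> asks for all linear ones. So some representing \<open>T\<close> is taken
  first and then identified with \<open>P\<close>, since bounded functionals separate
  points.\<close>

lemma represents_identity_tensor: "represents P identity_tensor"
proof -
  obtain T where T: "represents T identity_tensor"
    using tensor_represented[OF identity_tensor_in] by blast
  have "T \<xi> = P \<xi>" for \<xi>
  proof (rule functionals_separate_points)
    fix f assume f: "bounded_operator sc (*) f"
    then have "f (T \<xi>) = functional_restrict f (P \<xi>)"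
      using represents_form[OF T, of f \<xi>] identity_tensor_form[OF f linear_form_eval, of "P \<xi>"]
      by (simp add: bounded_operator_def)
    then show "f (T \<xi>) = f (P \<xi>)" by (simp add: functional_restrict_def P_in)
  qed
  then have "T = P" by (rule ext)
  with T show ?thesis by simp
qed

text \<open>With the identity tensor as \<open>w\<close> the representing operator is
  \<open>P\<close>, which fixes \<open>N\<close> and hence every tensor over \<open>N\<close>. Thus
  a tensor over \<open>N\<close> can be recovered from its operator.\<close>

lemma tensor_map_slice_identity_tensor:
  assumes E: "linear_space E" and u: "u \<in> tensor_product sc N E"
  shows "tensor_map sc E id (\<lambda>g. slice E u (\<lambda>\<xi>. g (P \<xi>))) identity_tensor = u"
proof -
  have "tensor_map sc E id (\<lambda>g. slice E u (\<lambda>\<xi>. g (P \<xi>))) identity_tensor = tensor_map sc E P id u"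
    by (rule tensor_map_slice[OF E identity_tensor_in represents_identity_tensor u])
  also have "\<dots> = tensor_map sc E id id u"
    by (rule tensor_map_cong[OF u linear_P linear_id linear_map_id linear_map_id])
      (simp_all add: P_id)
  also have "\<dots> = u" by (rule tensor_map_id[OF u])
  finally show ?thesis .
qed

abbreviation F :: "('k, 'l, 'l \<Rightarrow> 'k) lspace"
  where "F \<equiv> minimal_lspace sc D (dual_norm N)"

text \<open>For definiteness, a \<open>w\<close> of norm zero has representing operator
  \<open>T = 0\<close>. The identity tensor gives the identity operator of \<open>D\<close>, so
  \<open>w\<close> itself is \<open>T \<otimes> 1\<close> applied to the identity tensor, which is
  zero.\<close>

lemma is_lspace_F: "is_lspace sc F"
proof (rule is_lspace_minimal_lspace[OF linear_space_dual_space dual_norm_nonneg])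
  fix w assume w: "w \<in> tensor_product sc UNIV D" and zero: "injective_norm sc D (dual_norm N) w = 0"
  obtain T where T: "represents T w" using tensor_represented[OF w] by blast
  have T_op: "bounded_linear T" "Vector_Spaces.linear sc sc T"
    using represents_bounded_operator[OF T] by (simp_all add: bounded_operator_def)
  have T_zero: "T \<xi> = 0" for \<xi>
  proof -
    have "norm (T \<xi>) \<le> onorm T * norm \<xi>" by (rule onorm[OF T_op(1)])
    also have "\<dots> \<le> 0 * norm \<xi>"
      using onorm_le_injective_norm[OF w T] zero by (intro mult_right_mono) auto
    finally show ?thesis by simp
  qed
  have "w = tensor_map sc D id id w"
    by (rule tensor_map_id[OF w, symmetric])
  also have "\<dots> = tensor_map sc D id (\<lambda>g. slice D identity_tensor (\<lambda>\<xi>. g (P \<xi>))) w"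
    by (rule tensor_map_cong[OF w linear_id linear_id linear_map_id
          linear_map_slice[OF linear_space_dual_space identity_tensor_in]])
      (simp_all add: slice_identity_tensor)
  also have "\<dots> = tensor_map sc D T id identity_tensor"
    by (rule tensor_map_slice[OF linear_space_dual_space w T identity_tensor_in])
  also have "\<dots> = (\<lambda>_. 0)"
  proof
    fix B
    have "identity_tensor (\<lambda>\<xi> x. B (T \<xi>) (id x)) = identity_tensor (\<lambda>_ _. 0)"
      if B: "B \<in> bilinear_forms sc D"
    proof (rule tensor_form_cong[OF identity_tensor_in bilinear_forms_compose[OF T_op(2) linear_map_id B]])
      show "(\<lambda>_ _. 0) \<in> bilinear_forms sc D"
        by (simp add: bilinear_forms_iff linear_form_def)
      fix \<xi> and x assume x: "x \<in> carrier D"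
      have "B (sc 0 0) x = 0 * B 0 x" using B x unfolding bilinear_forms_iff by blast
      then show "B (T \<xi>) (id x) = 0" by (simp add: T_zero)
    qed
    then show "tensor_map sc D T id identity_tensor B = 0"
      by (simp add: tensor_map_def tensor_form_zero[OF identity_tensor_in])
  qed
  finally show "w = (\<lambda>_. 0)" .
qed

section \<open>The bijection between the unit ball and the contractive operators\<close>

definition slice_operator :: "('k, 'l, 'e) lspace \<Rightarrow> ('k, 'l, 'e) tensor \<Rightarrow> ('l \<Rightarrow> 'k) \<Rightarrow> 'e"
  where "slice_operator E u = (\<lambda>g\<in>carrier D. slice E u (\<lambda>\<xi>. g (P \<xi>)))"

lemma linear_map_slice_operator:
  assumes "linear_space E" "u \<in> tensor_product sc M E"
  shows "linear_map D E (slice_operator E u)"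
  using linear_map_slice[OF assms] linear_space_closed[OF linear_space_dual_space[of sc N]]
  by (simp add: slice_operator_def linear_map_def Pi_iff del: dual_space_simps)

lemma tensor_map_slice_operator:
  assumes E: "linear_space E" and u: "u \<in> tensor_product sc M E" and w: "w \<in> tensor_product sc M' D"
  shows "tensor_map sc E id (slice_operator E u) w
    = tensor_map sc E id (\<lambda>g. slice E u (\<lambda>\<xi>. g (P \<xi>))) w"
  by (rule tensor_map_cong[OF w linear_id linear_id linear_map_slice_operator[OF E u]
        linear_map_slice[OF E u]]) (simp_all add: slice_operator_def)

lemma slice_operator_contractive:
  assumes E: "is_lspace sc E" and u: "u \<in> odot_ob sc N E"
  shows "slice_operator E u \<in> lcontractive_operators sc F E"
proof -
  have E_lin: "linear_space E" using E by (simp add: is_lspace_def)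
  have u_in: "u \<in> tensor_product sc N E" and u_le: "lnorm E u \<le> 1"
    using u by (simp_all add: odot_ob_def)
  have u_UNIV: "u \<in> tensor_product sc UNIV E" using u_in tensor_product_mono[of N UNIV] by blast
  have "slice_operator E u \<in> linear_operators D E"
    using linear_map_slice_operator[OF E_lin u_in]
    by (simp add: linear_operators_def linear_map_def PiE_iff Pi_iff slice_operator_def
        del: dual_space_simps)
  moreover have "lnorm E (tensor_map sc E id (slice_operator E u) w) \<le> injective_norm sc D (dual_norm N) w"
    if w: "w \<in> tensor_product sc UNIV D" for w
  proof -
    obtain T where T: "represents T w" using tensor_represented[OF w] by blast
    have "tensor_map sc E id (slice_operator E u) w = tensor_map sc E T id u"
      by (simp only: tensor_map_slice_operator[OF E_lin u_in w] tensor_map_slice[OF E_lin w T u_in])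
    \<comment> \<open>The L-norm axiom of \<open>E\<close> applies because \<open>T\<close>, with
      \<open>P\<close> built in, is defined on all of \<open>L\<close>.\<close>
    moreover have "lnorm E (tensor_map sc E T id u) \<le> onorm T * lnorm E u"
      using E u_UNIV represents_bounded_operator[OF T] by (simp add: is_lspace_def)
    moreover have "onorm T * lnorm E u \<le> onorm T * 1"
      using u_le represents_bounded_operator[OF T]
      by (intro mult_left_mono onorm_pos_le) (simp_all add: bounded_operator_def)
    ultimately show ?thesis using onorm_le_injective_norm[OF w T] by simp
  qed
  ultimately show ?thesis by (simp add: lcontractive_operators_def)
qed

lemma tensor_map_identity_tensor_in_odot:
  assumes \<phi>: "\<phi> \<in> lcontractive_operators sc F E"
  shows "tensor_map sc E id \<phi> identity_tensor \<in> odot_ob sc N E"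
proof -
  have "linear_map D E \<phi>"
    using \<phi> by (simp add: lcontractive_operators_def linear_operators_imp_linear_map)
  then have "tensor_map sc E id \<phi> identity_tensor \<in> tensor_product sc N E"
    using linear_id identity_tensor_in by (intro tensor_map_in_tensor_product) auto
  moreover have "lnorm E (tensor_map sc E id \<phi> identity_tensor) \<le> 1"
    using \<phi> identity_tensor_in_UNIV injective_norm_identity_tensor
    by (auto simp: lcontractive_operators_def intro: order.trans)
  ultimately show ?thesis by (simp add: odot_ob_def)
qed

text \<open>On the carrier, slices commute with \<phi> and the slice of the identity tensor at
  \<open>g\<close> is \<open>g\<close>; off the carrier both sides are
  \<open>undefined\<close>.\<close>

lemma slice_operator_tensor_map:
  assumes E: "linear_space E" and \<phi>: "\<phi> \<in> linear_operators D E"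
  shows "slice_operator E (tensor_map sc E id \<phi> identity_tensor) = \<phi>"
proof
  fix g
  have "slice E (tensor_map sc E id \<phi> identity_tensor) (\<lambda>\<xi>. g (P \<xi>)) = \<phi> g" if g: "g \<in> carrier D"
    using slice_tensor_map[OF linear_space_dual_space E linear_dual_extension[OF g] identity_tensor_in
        linear_operators_imp_linear_map[OF \<phi>]]
    by (simp add: slice_identity_tensor[OF g])
  moreover have "\<phi> g = undefined" if "g \<notin> carrier D"
    using \<phi> that PiE_arb[of \<phi> "carrier D" "\<lambda>_. carrier E"] unfolding linear_operators_def by blast
  ultimately show "slice_operator E (tensor_map sc E id \<phi> identity_tensor) g = \<phi> g"
    unfolding slice_operator_def by (cases "g \<in> carrier D") simp_all
qed

lemma bij_betw_slice_operator:
  assumes E: "is_lspace sc E"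
  shows "bij_betw (\<lambda>f. slice_operator E (f m)) ({m} \<rightarrow>\<^sub>E odot_ob sc N E) (lcontractive_operators sc F E)"
proof (rule bij_betw_byWitness[where f' = "\<lambda>\<phi>. \<lambda>x\<in>{m}. tensor_map sc E id \<phi> identity_tensor"])
  have E_lin: "linear_space E" using E by (simp add: is_lspace_def)
  show "\<forall>f\<in>{m} \<rightarrow>\<^sub>E odot_ob sc N E.
      (\<lambda>x\<in>{m}. tensor_map sc E id (slice_operator E (f m)) identity_tensor) = f"
  proof
    fix f assume f: "f \<in> {m} \<rightarrow>\<^sub>E odot_ob sc N E"
    then have fm: "f m \<in> tensor_product sc N E" by (auto simp: odot_ob_def)
    have "tensor_map sc E id (slice_operator E (f m)) identity_tensor = f m"
      by (simp only: tensor_map_slice_operator[OF E_lin fm identity_tensor_in]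
          tensor_map_slice_identity_tensor[OF E_lin fm])
    then show "(\<lambda>x\<in>{m}. tensor_map sc E id (slice_operator E (f m)) identity_tensor) = f"
      using PiE_restrict[OF f] by (metis (no_types, lifting) restrict_ext singletonD)
  qed
  show "\<forall>\<phi>\<in>lcontractive_operators sc F E.
      slice_operator E ((\<lambda>x\<in>{m}. tensor_map sc E id \<phi> identity_tensor) m) = \<phi>"
    by (auto simp: lcontractive_operators_def intro: slice_operator_tensor_map[OF E_lin])
  show "(\<lambda>f. slice_operator E (f m)) ` ({m} \<rightarrow>\<^sub>E odot_ob sc N E) \<subseteq> lcontractive_operators sc F E"
    by (auto intro!: slice_operator_contractive[OF E])
  show "(\<lambda>\<phi>. \<lambda>x\<in>{m}. tensor_map sc E id \<phi> identity_tensor) ` lcontractive_operators sc F E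
      \<subseteq> {m} \<rightarrow>\<^sub>E odot_ob sc N E"
    by (auto intro!: tensor_map_identity_tensor_in_odot)
qed

text \<open>Slicing the first factor commutes with \<phi> on the second; membership of
  \<open>u\<close> in the unit ball makes the restricted map \<open>odot_ar\<close> agree with the
  tensor map at \<open>u\<close>.\<close>

lemma slice_operator_natural:
  assumes G: "is_lspace sc G" and E: "is_lspace sc E"
    and \<phi>: "\<phi> \<in> lcontractive_operators sc G E" and u: "u \<in> odot_ob sc N G"
  shows "compose (carrier F) \<phi> (slice_operator G u) = slice_operator E (odot_ar sc N G E \<phi> u)"
proof
  fix g
  have lin: "linear_space G" "linear_space E" using G E by (simp_all add: is_lspace_def)
  have "linear_map G E \<phi>"
    using \<phi> by (simp add: lcontractive_operators_def linear_operators_imp_linear_map)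
  then have "slice E (tensor_map sc E id \<phi> u) (\<lambda>\<xi>. g (P \<xi>)) = \<phi> (slice G u (\<lambda>\<xi>. g (P \<xi>)))"
    if g: "g \<in> carrier D"
    using slice_tensor_map[OF lin linear_dual_extension[OF g]] u by (auto simp: odot_ob_def)
  then show "compose (carrier F) \<phi> (slice_operator G u) g = slice_operator E (odot_ar sc N G E \<phi> u) g"
    using u by (simp add: compose_def slice_operator_def odot_ar_def)
qed

end

theorem proposition2p11:
  fixes sc :: "'k::real_or_complex \<Rightarrow> 'l::real_normed_vector \<Rightarrow> 'l"
    and N :: "'l set" and m :: 'm
  assumes "normed_space sc"
    and "contractively_complemented sc N"
    and "finite_dimensional sc N"
  shows "is_free_lspace sc
           (odot_ob sc N :: ('k, 'l, 'e) lspace \<Rightarrow> ('k, 'l, 'e) tensor set) (odot_ar sc N)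
           {m} (minimal_lspace sc (dual_space sc N) (dual_norm N))"
proof -
  obtain P where P: "bounded_operator sc sc P" "P \<circ> P = P" "onorm P \<le> 1" "range P = N"
    using assms(2) by (auto simp: contractively_complemented_def)
  interpret findim_complemented_subspace sc P N
    by (intro findim_complemented_subspace.intro complemented_subspace.intro
        complemented_subspace_axioms.intro findim_complemented_subspace_axioms.intro assms(1,3) P)
  show ?thesis
    unfolding is_free_lspace_def
  proof (intro conjI exI[of _ "\<lambda>E f. slice_operator E (f m)"] allI impI ballI is_lspace_F
      bij_betw_slice_operator)
    fix G E :: "('k, 'l, 'e) lspace" and \<phi> f
    assume *: "is_lspace sc G" "is_lspace sc E" "\<phi> \<in> lcontractive_operators sc G E"
      "f \<in> {m} \<rightarrow>\<^sub>E odot_ob sc N G"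
    then have fm: "f m \<in> odot_ob sc N G" by auto
    have "compose {m} (odot_ar sc N G E \<phi>) f m = odot_ar sc N G E \<phi> (f m)"
      by (simp add: compose_def)
    then show "compose (carrier F) \<phi> (slice_operator G (f m))
        = slice_operator E (compose {m} (odot_ar sc N G E \<phi>) f m)"
      using slice_operator_natural[OF *(1-3) fm] by (simp only:)
  qed
qed

end
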